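(* Let $\Gamma=(V,E)$ be a finite simplicial graph and let $\mathcal{G}=\{G_v\}_{v\in V}$ be a collection of groups linear over $\mathbb{C}$. Then the graph product $\Gamma\mathcal{G}$ is linear over $\mathbb{C}$.
   Context: A group is linear over $\mathbb{C}$ if it is isomorphic to a subgroup of $\mathrm{GL}_n(\mathbb{C})$ for some $n\ge 1$. A simplicial graph has no loops and no multiple edges. The graph product is $$\Gamma\mathcal{G}=\langle \ast_{v\in V}G_v \mid [G_v,G_u]=e \text{ for all } \{v,u\}\in E\rangle,$$ i.e. the quotient of the free product of the $G_v$ obtained by making $G_v$ and $G_u$ commute elementwise whenever $\{v,u\}\in E$. *)

theory Defs
  imports "HOL-Algebra.Algebra" "Jordan_Normal_Form.Matrix"
begin

section \<open>Linear groups\<close>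

definition GL :: "nat \<Rightarrow> complex mat monoid" where
  "GL n = units_of (ring_mat TYPE(complex) n ())"

lemma group_GL: "group (GL n)"
proof -
  interpret R: ring "ring_mat TYPE(complex) n ()" by (rule ring_mat)
  show ?thesis unfolding GL_def by (rule R.units_group)
qed

lemma carrier_GL: "carrier (GL n) = {A \<in> carrier_mat n n. invertible_mat A}"
proof -
  have "A \<in> Units (ring_mat TYPE(complex) n ()) \<longleftrightarrow> A \<in> carrier_mat n n \<and> invertible_mat A"
    for A :: "complex mat"
  proof
    assume "A \<in> Units (ring_mat TYPE(complex) n ())"
    then show "A \<in> carrier_mat n n \<and> invertible_mat A"
      unfolding Units_def ring_mat_simps invertible_mat_def inverts_mat_def by auto
  next
    assume A: "A \<in> carrier_mat n n \<and> invertible_mat A"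
    then obtain B where B: "A * B = 1\<^sub>m n" "B * A = 1\<^sub>m (dim_row B)"
      unfolding invertible_mat_def inverts_mat_def by auto
    have "dim_col B = n" "dim_row B = n"
      using arg_cong[OF B(1), of dim_col] arg_cong[OF B(2), of dim_col] A by auto
    then show "A \<in> Units (ring_mat TYPE(complex) n ())"
      using A B unfolding Units_def ring_mat_simps by auto
  qed
  then show ?thesis
    by (auto simp: GL_def units_of_def)
qed

text \<open>
  The group condition is explicit because isomorphism of monoid records to a group does not imply it.
\<close>

definition linear_over_complex :: "('a, 'b) monoid_scheme \<Rightarrow> bool" where
  "linear_over_complex G \<longleftrightarrow>
     group G \<and> (\<exists>n\<ge>1. \<exists>H. subgroup H (GL n) \<and> G \<cong> GL n\<lparr>carrier := H\<rparr>)"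


section \<open>Simplicial graphs\<close>

definition simplicial_graph :: "'v set \<Rightarrow> 'v set set \<Rightarrow> bool" where
  "simplicial_graph V E \<longleftrightarrow> (\<forall>e\<in>E. e \<subseteq> V \<and> card e = 2)"


section \<open>Free products\<close>

definition fp_words :: "'v set \<Rightarrow> ('v \<Rightarrow> ('a, 'b) monoid_scheme) \<Rightarrow> ('v \<times> 'a) list set" where
  "fp_words V G = lists (SIGMA v:V. carrier (G v))"

text \<open>
  The smallest congruence on words that identifies the product of two adjacent letters from the
  same factor with their product in that factor, and the identity of each factor with the empty
  word.
\<close>

inductive_set fp_rel :: "'v set \<Rightarrow> ('v \<Rightarrow> ('a, 'b) monoid_scheme) \<Rightarrow> (('v \<times> 'a) list \<times> ('v \<times> 'a) list) set"
  for V :: "'v set" and G :: "'v \<Rightarrow> ('a, 'b) monoid_scheme"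
where
  refl: "w \<in> fp_words V G \<Longrightarrow> (w, w) \<in> fp_rel V G"
| sym: "(w, w') \<in> fp_rel V G \<Longrightarrow> (w', w) \<in> fp_rel V G"
| trans: "(w, w') \<in> fp_rel V G \<Longrightarrow> (w', w'') \<in> fp_rel V G \<Longrightarrow> (w, w'') \<in> fp_rel V G"
| mult: "xs \<in> fp_words V G \<Longrightarrow> ys \<in> fp_words V G \<Longrightarrow> v \<in> V \<Longrightarrow> g \<in> carrier (G v) \<Longrightarrow> h \<in> carrier (G v) \<Longrightarrow>
    (xs @ [(v, g), (v, h)] @ ys, xs @ [(v, g \<otimes>\<^bsub>G v\<^esub> h)] @ ys) \<in> fp_rel V G"
| one: "xs \<in> fp_words V G \<Longrightarrow> ys \<in> fp_words V G \<Longrightarrow> v \<in> V \<Longrightarrow>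
    (xs @ [(v, \<one>\<^bsub>G v\<^esub>)] @ ys, xs @ ys) \<in> fp_rel V G"

definition free_product :: "'v set \<Rightarrow> ('v \<Rightarrow> ('a, 'b) monoid_scheme) \<Rightarrow> ('v \<times> 'a) list set monoid" where
  "free_product V G =
     \<lparr>carrier = fp_words V G // fp_rel V G,
      monoid.mult = (\<lambda>A B. \<Union>x\<in>A. \<Union>y\<in>B. fp_rel V G `` {x @ y}),
      one = fp_rel V G `` {[]}\<rparr>"

definition fp_incl :: "'v set \<Rightarrow> ('v \<Rightarrow> ('a, 'b) monoid_scheme) \<Rightarrow> 'v \<Rightarrow> 'a \<Rightarrow> ('v \<times> 'a) list set" where
  "fp_incl V G v g = fp_rel V G `` {[(v, g)]}"


section \<open>Graph products\<close>

definition group_commutator :: "('a, 'b) monoid_scheme \<Rightarrow> 'a \<Rightarrow> 'a \<Rightarrow> 'a" where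
  "group_commutator G x y = x \<otimes>\<^bsub>G\<^esub> y \<otimes>\<^bsub>G\<^esub> inv\<^bsub>G\<^esub> x \<otimes>\<^bsub>G\<^esub> inv\<^bsub>G\<^esub> y"

definition normal_closure :: "('a, 'b) monoid_scheme \<Rightarrow> 'a set \<Rightarrow> 'a set" where
  "normal_closure G S = \<Inter>{N. N \<lhd> G \<and> S \<subseteq> N}"

definition graph_product_relators ::
  "'v set \<Rightarrow> 'v set set \<Rightarrow> ('v \<Rightarrow> ('a, 'b) monoid_scheme) \<Rightarrow> ('v \<times> 'a) list set set" where
  "graph_product_relators V E G =
     {group_commutator (free_product V G) (fp_incl V G v g) (fp_incl V G u h) | v g u h.
        {v, u} \<in> E \<and> g \<in> carrier (G v) \<and> h \<in> carrier (G u)}"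

definition graph_product ::
  "'v set \<Rightarrow> 'v set set \<Rightarrow> ('v \<Rightarrow> ('a, 'b) monoid_scheme) \<Rightarrow> ('v \<times> 'a) list set set monoid" where
  "graph_product V E G =
     free_product V G Mod normal_closure (free_product V G) (graph_product_relators V E G)"


section \<open>Well-definedness\<close>

lemma Nil_fp_words [simp]: "[] \<in> fp_words V G"
  by (simp add: fp_words_def)

lemma Cons_fp_words [simp]:
  "(v, g) # w \<in> fp_words V G \<longleftrightarrow> v \<in> V \<and> g \<in> carrier (G v) \<and> w \<in> fp_words V G"
  by (auto simp: fp_words_def)

lemma append_fp_words [simp]:
  "xs @ ys \<in> fp_words V G \<longleftrightarrow> xs \<in> fp_words V G \<and> ys \<in> fp_words V G"
  by (auto simp: fp_words_def)

lemma fp_rel_append_left: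
  assumes "(w, w') \<in> fp_rel V G" "z \<in> fp_words V G"
  shows "(z @ w, z @ w') \<in> fp_rel V G"
  using assms
proof (induction rule: fp_rel.induct)
  case (mult xs ys v g h)
  then show ?case using fp_rel.mult[of "z @ xs" V G ys v g h] by simp
next
  case (one xs ys v)
  then show ?case using fp_rel.one[of "z @ xs" V G ys v] by simp
qed (auto intro: fp_rel.refl fp_rel.sym fp_rel.trans)

lemma fp_rel_append_right:
  assumes "(w, w') \<in> fp_rel V G" "z \<in> fp_words V G"
  shows "(w @ z, w' @ z) \<in> fp_rel V G"
  using assms
proof (induction rule: fp_rel.induct)
  case (mult xs ys v g h)
  then show ?case using fp_rel.mult[of xs V G "ys @ z" v g h] by simp
next
  case (one xs ys v)
  then show ?case using fp_rel.one[of xs V G "ys @ z" v] by simp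
qed (auto intro: fp_rel.refl fp_rel.sym fp_rel.trans)

locale group_family =
  fixes V :: "'v set" and G :: "'v \<Rightarrow> ('a, 'b) monoid_scheme"
  assumes grp: "v \<in> V \<Longrightarrow> group (G v)"
begin

lemma fp_rel_words:
  assumes "(w, w') \<in> fp_rel V G"
  shows "w \<in> fp_words V G \<and> w' \<in> fp_words V G"
  using assms
proof (induction rule: fp_rel.induct)
  case (mult xs ys v g h)
  then interpret group "G v" by (intro grp)
  show ?case using mult by simp
next
  case (one xs ys v)
  then interpret group "G v" by (intro grp)
  show ?case using one by simp
qed auto

lemma equiv_fp_rel: "equiv (fp_words V G) (fp_rel V G)"
  by (rule equivI)
     (use fp_rel_words in \<open>auto simp: refl_on_def sym_def trans_def intro: fp_rel.intros\<close>)

lemma fp_rel_append: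
  assumes "(x, x') \<in> fp_rel V G" "(y, y') \<in> fp_rel V G"
  shows "(x @ y, x' @ y') \<in> fp_rel V G"
  using assms fp_rel_append_left fp_rel_append_right fp_rel_words fp_rel.trans by meson

lemma fp_mult:
  assumes "x \<in> fp_words V G" "y \<in> fp_words V G"
  shows "fp_rel V G `` {x} \<otimes>\<^bsub>free_product V G\<^esub> fp_rel V G `` {y} = fp_rel V G `` {x @ y}"
proof -
  have "(\<lambda>x y. fp_rel V G `` {x @ y}) respects2 fp_rel V G"
    by (intro congruent2I' equiv_class_eq[OF equiv_fp_rel] fp_rel_append)
  then show ?thesis
    using assms UN_equiv_class2[OF equiv_fp_rel equiv_fp_rel] by (simp add: free_product_def)
qed

lemma fp_inverse_word:
  assumes "x \<in> fp_words V G"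
  shows "\<exists>y\<in>fp_words V G. (y @ x, []) \<in> fp_rel V G"
  using assms
proof (induction x)
  case Nil
  show ?case by (auto intro!: bexI[of _ "[]"] fp_rel.refl)
next
  case (Cons a w)
  obtain v g where a: "a = (v, g)" by (cases a)
  from Cons.prems a have v: "v \<in> V" "g \<in> carrier (G v)" "w \<in> fp_words V G" by auto
  interpret group "G v" using v by (intro grp)
  obtain y where y: "y \<in> fp_words V G" "(y @ w, []) \<in> fp_rel V G" using Cons.IH v by auto
  let ?y = "y @ [(v, inv\<^bsub>G v\<^esub> g)]"
  have "(?y @ a # w, y @ [(v, \<one>\<^bsub>G v\<^esub>)] @ w) \<in> fp_rel V G"
    using fp_rel.mult[of y V G w v "inv\<^bsub>G v\<^esub> g" g] v y a by simp
  moreover have "(y @ [(v, \<one>\<^bsub>G v\<^esub>)] @ w, y @ w) \<in> fp_rel V G"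
    using v y by (intro fp_rel.one)
  ultimately have "(?y @ a # w, []) \<in> fp_rel V G"
    using y(2) fp_rel.trans by meson
  moreover have "?y \<in> fp_words V G" using v y by simp
  ultimately show ?case by blast
qed

lemma group_free_product: "group (free_product V G)"
proof (rule groupI)
  have car: "carrier (free_product V G) = fp_words V G // fp_rel V G"
    and one: "\<one>\<^bsub>free_product V G\<^esub> = fp_rel V G `` {[]}"
    by (simp_all add: free_product_def)
  show "\<one>\<^bsub>free_product V G\<^esub> \<in> carrier (free_product V G)"
    by (simp add: car one quotientI)
  fix A assume "A \<in> carrier (free_product V G)"
  then obtain x where x: "x \<in> fp_words V G" "A = fp_rel V G `` {x}"
    by (auto simp: car elim: quotientE)
  show "\<one>\<^bsub>free_product V G\<^esub> \<otimes>\<^bsub>free_product V G\<^esub> A = A"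
    using x by (simp add: one fp_mult)
  obtain y where y: "y \<in> fp_words V G" "(y @ x, []) \<in> fp_rel V G"
    using fp_inverse_word x by blast
  then have "fp_rel V G `` {y} \<otimes>\<^bsub>free_product V G\<^esub> A = \<one>\<^bsub>free_product V G\<^esub>"
    using x equiv_class_eq[OF equiv_fp_rel y(2)] by (simp add: one fp_mult)
  then show "\<exists>B\<in>carrier (free_product V G). B \<otimes>\<^bsub>free_product V G\<^esub> A = \<one>\<^bsub>free_product V G\<^esub>"
    using y by (auto simp: car intro: quotientI)
  fix B assume "B \<in> carrier (free_product V G)"
  then obtain y where y: "y \<in> fp_words V G" "B = fp_rel V G `` {y}"
    by (auto simp: car elim: quotientE)
  show "A \<otimes>\<^bsub>free_product V G\<^esub> B \<in> carrier (free_product V G)"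
    using x y by (simp add: fp_mult car quotientI)
  fix C assume "C \<in> carrier (free_product V G)"
  then obtain z where z: "z \<in> fp_words V G" "C = fp_rel V G `` {z}"
    by (auto simp: car elim: quotientE)
  show "A \<otimes>\<^bsub>free_product V G\<^esub> B \<otimes>\<^bsub>free_product V G\<^esub> C =
        A \<otimes>\<^bsub>free_product V G\<^esub> (B \<otimes>\<^bsub>free_product V G\<^esub> C)"
    using x y z by (simp add: fp_mult)
qed

lemma fp_incl_hom:
  assumes "v \<in> V"
  shows "fp_incl V G v \<in> hom (G v) (free_product V G)"
proof (rule homI)
  fix g h assume g: "g \<in> carrier (G v)"
  then show "fp_incl V G v g \<in> carrier (free_product V G)"
    using assms by (simp add: free_product_def fp_incl_def quotientI)
  assume h: "h \<in> carrier (G v)"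
  show "fp_incl V G v (g \<otimes>\<^bsub>G v\<^esub> h) = fp_incl V G v g \<otimes>\<^bsub>free_product V G\<^esub> fp_incl V G v h"
    using assms g h equiv_class_eq[OF equiv_fp_rel fp_rel.mult[of "[]" V G "[]" v g h]]
    by (simp add: fp_incl_def fp_mult)
qed

end

lemma (in group) normal_normal_closure:
  assumes "S \<subseteq> carrier G"
  shows "normal_closure G S \<lhd> G"
proof -
  have ne: "carrier G \<in> {N. N \<lhd> G \<and> S \<subseteq> N}"
    using assms by (auto simp: normal_inv_iff subgroup_self)
  have "subgroup (\<Inter>{N. N \<lhd> G \<and> S \<subseteq> N}) G"
    using ne by (intro subgroups_Inter) (auto simp: normal_inv_iff)
  then show ?thesis
    by (auto simp: normal_inv_iff normal_closure_def)
qed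

lemma (in group_family) group_graph_product:
  assumes "simplicial_graph V E"
  shows "group (graph_product V E G)"
proof -
  interpret F: group "free_product V G" by (rule group_free_product)
  have "fp_incl V G v g \<in> carrier (free_product V G)" if "v \<in> V" "g \<in> carrier (G v)" for v g
    using fp_incl_hom that by (auto simp: hom_def)
  moreover have "v \<in> V \<and> u \<in> V" if "{v, u} \<in> E" for v u
    using assms that by (auto simp: simplicial_graph_def)
  ultimately have "graph_product_relators V E G \<subseteq> carrier (free_product V G)"
    by (auto simp: graph_product_relators_def group_commutator_def)
  then show ?thesis
    unfolding graph_product_def by (intro normal.factorgroup_is_group F.normal_normal_closure)
qed

end

theory Submission
  imports Defs "HOL-Analysis.Continuum_Not_Denumerable"
    "HOL-Computational_Algebra.Fundamental_Theorem_Algebra"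
begin

text \<open>
  A linear group has a representation \<open>R\<close> with a vector \<open>p\<close> and a functional \<open>q\<close> such that
  \<open>q (R g - 1) p = \<parallel>g - 1\<parallel>\<^sup>2\<close>, which is positive for \<open>g \<noteq> 1\<close>. On the direct sum of these
  representations and a base line, with coefficients in \<open>\<complex>[t]\<close>, let \<open>g\<close> in the vertex group of \<open>v\<close>
  change only the block of \<open>v\<close>, by \<open>y \<mapsto> R g y + t s (R g - 1) p\<close>, where \<open>s\<close> adds up the base
  coordinate and the values of the \<open>q\<close> on the blocks of the vertices not joined to \<open>v\<close>. This defines
  an action of the graph product. Applying a reduced word to the base vector, each letter raises the
  degree in \<open>t\<close> of its block above the degrees of all blocks it does not commute with, and no leading terms
  cancel because they are positive; hence the action is faithful. Finally \<open>\<complex>[t]\<close> embeds into \<open>\<complex>\<close>: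
  by Steinitz, some endomorphism of \<open>\<complex>\<close> misses an element of a transcendence basis.
\<close>

section \<open>Embedding the polynomial ring into the complex numbers\<close>

text \<open>The vertex groups need not be finitely generated, so their matrix entries may generate
  all of \<complex> and leave no transcendental number to serve as \<open>t\<close>. This is why the
  scalars themselves are moved by an endomorphism before \<open>t\<close> is specialised. Several
  blocks of equal degree may feed the same inflow, so leading coefficients that are merely nonzero
  could add up to zero. A single pair \<open>q\<close>, \<open>p\<close> therefore has to give a
  positive number for every \<open>g \<noteq> 1\<close> at once, and a sum of squared moduli does
  so. Every word can be rewritten as a reduced one in the same coset of the relators. Hence
  nontriviality on nonempty reduced words shows that the kernel of the action of the free product is
  exactly the normal closure of the relators.\<close>

inductive_set ring_hull :: "complex set \<Rightarrow> complex set" for S where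
  one: "1 \<in> ring_hull S"
| base: "x \<in> S \<Longrightarrow> x \<in> ring_hull S"
| diff: "x \<in> ring_hull S \<Longrightarrow> y \<in> ring_hull S \<Longrightarrow> x - y \<in> ring_hull S"
| mult: "x \<in> ring_hull S \<Longrightarrow> y \<in> ring_hull S \<Longrightarrow> x * y \<in> ring_hull S"

definition subrng :: "complex set \<Rightarrow> bool" where
  "subrng R \<longleftrightarrow> 1 \<in> R \<and> (\<forall>x\<in>R. \<forall>y\<in>R. x - y \<in> R \<and> x * y \<in> R)"

definition polys_over :: "complex set \<Rightarrow> complex poly set" where
  "polys_over R = {p. \<forall>i. coeff p i \<in> R}"

text \<open>When \<open>R\<close> is a subring, clearing denominators turns a relation over its
  fraction field into one over \<open>R\<close>, so this is the usual notion of algebraicity. It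
  allows all constructions to stay within rings.\<close>

definition alg_over :: "complex set \<Rightarrow> complex set" where
  "alg_over R = {x. \<exists>p\<in>polys_over R. p \<noteq> 0 \<and> poly p x = 0}"

lemma subrng_ring_hull: "subrng (ring_hull S)"
  by (auto simp: subrng_def intro: ring_hull.intros)

lemma ring_hull_least: "S \<subseteq> R \<Longrightarrow> subrng R \<Longrightarrow> ring_hull S \<subseteq> R"
proof
  fix x assume "S \<subseteq> R" "subrng R" "x \<in> ring_hull S"
  then show "x \<in> R" by (induction rule: ring_hull.induct[OF \<open>x \<in> ring_hull S\<close>]) (auto simp: subrng_def)
qed

lemma ring_hull_mono: "S \<subseteq> T \<Longrightarrow> ring_hull S \<subseteq> ring_hull T"
  by (intro ring_hull_least subrng_ring_hull) (auto intro: ring_hull.base)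

lemma ring_hull_finite:
  assumes "x \<in> ring_hull S"
  shows "\<exists>F. finite F \<and> F \<subseteq> S \<and> x \<in> ring_hull F"
  using assms
proof (induction rule: ring_hull.induct)
  case one
  then show ?case by (intro exI[of _ "{}"]) (auto intro: ring_hull.intros)
next
  case (base x)
  then show ?case by (intro exI[of _ "{x}"]) (auto intro: ring_hull.intros)
next
  case (diff x y)
  then obtain F F' where "finite F \<and> F \<subseteq> S \<and> x \<in> ring_hull F" "finite F' \<and> F' \<subseteq> S \<and> y \<in> ring_hull F'"
    by blast
  then show ?case using ring_hull_mono[of F "F \<union> F'"] ring_hull_mono[of F' "F \<union> F'"]
    by (intro exI[of _ "F \<union> F'"]) (auto intro: ring_hull.intros)
next
  case (mult x y)
  then obtain F F' where "finite F \<and> F \<subseteq> S \<and> x \<in> ring_hull F" "finite F' \<and> F' \<subseteq> S \<and> y \<in> ring_hull F'"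
    by blast
  then show ?case using ring_hull_mono[of F "F \<union> F'"] ring_hull_mono[of F' "F \<union> F'"]
    by (intro exI[of _ "F \<union> F'"]) (auto intro: ring_hull.intros)
qed

lemma subrng_0: "subrng R \<Longrightarrow> 0 \<in> R"
  unfolding subrng_def by (metis diff_self)

lemma subrng_add: "subrng R \<Longrightarrow> x \<in> R \<Longrightarrow> y \<in> R \<Longrightarrow> x + y \<in> R"
  using subrng_0[of R] unfolding subrng_def by (metis diff_0 diff_minus_eq_add)

lemma subrng_sum: "subrng R \<Longrightarrow> (\<And>i. i \<in> A \<Longrightarrow> f i \<in> R) \<Longrightarrow> sum f A \<in> R"
  by (induction A rule: infinite_finite_induct) (auto simp: subrng_0 subrng_add)

definition adjoin :: "complex set \<Rightarrow> complex \<Rightarrow> complex set" where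
  "adjoin R x = (\<lambda>p. poly p x) ` polys_over R"

lemma subrng_adjoin:
  assumes "subrng R"
  shows "subrng (adjoin R x)"
proof -
  have 1: "1 \<in> polys_over R"
    using assms subrng_0[OF assms] by (auto simp: polys_over_def subrng_def coeff_1)
  have "p - q \<in> polys_over R" "p * q \<in> polys_over R" if "p \<in> polys_over R" "q \<in> polys_over R" for p q
    using that assms by (auto simp: polys_over_def subrng_def coeff_mult intro!: subrng_sum[OF assms])
  then show ?thesis
    unfolding subrng_def adjoin_def using 1
    by (auto simp flip: poly_diff poly_mult intro: image_eqI[of _ _ 1])
qed

lemma ring_hull_insert: "ring_hull (insert x S) \<subseteq> adjoin (ring_hull S) x"
proof (intro ring_hull_least subrng_adjoin subrng_ring_hull subsetI)
  have 0: "0 \<in> ring_hull S" by (rule subrng_0[OF subrng_ring_hull])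
  fix y assume "y \<in> insert x S"
  moreover have "[:y:] \<in> polys_over (ring_hull S)" if "y \<in> S"
    using that 0 by (auto simp: polys_over_def coeff_pCons ring_hull.base split: nat.splits)
  moreover have "[:0, 1:] \<in> polys_over (ring_hull S)"
    using 0 by (auto simp: polys_over_def coeff_pCons ring_hull.one split: nat.splits)
  ultimately show "y \<in> adjoin (ring_hull S) x"
    unfolding adjoin_def by (force intro: image_eqI[of _ _ "[:y:]"] image_eqI[of _ _ "[:0, 1:]"])
qed

lemma alg_over_mono: "R \<subseteq> R' \<Longrightarrow> alg_over R \<subseteq> alg_over R'"
  by (auto simp: alg_over_def polys_over_def)

text \<open>A relation has finitely many nonzero coefficients, and each of them involves finitely
  many generators. This finiteness carries independence over to unions of chains.\<close>

lemma alg_over_hull_finite: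
  assumes "x \<in> alg_over (ring_hull S)"
  shows "\<exists>F. finite F \<and> F \<subseteq> S \<and> x \<in> alg_over (ring_hull F)"
proof -
  obtain p where p: "p \<in> polys_over (ring_hull S)" "p \<noteq> 0" "poly p x = 0"
    using assms by (auto simp: alg_over_def)
  have "\<forall>i. \<exists>F. finite F \<and> F \<subseteq> S \<and> coeff p i \<in> ring_hull F"
    using p(1) ring_hull_finite by (auto simp: polys_over_def)
  then obtain f where f: "\<And>i. finite (f i) \<and> f i \<subseteq> S \<and> coeff p i \<in> ring_hull (f i)" by metis
  define F where "F = (\<Union>i\<le>degree p. f i)"
  have "coeff p i \<in> ring_hull F" for i
  proof (cases "i \<le> degree p")
    case True
    then show ?thesis using f ring_hull_mono[of "f i" F] by (auto simp: F_def)
  next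
    case False
    then show ?thesis by (simp add: coeff_eq_0 subrng_0[OF subrng_ring_hull])
  qed
  then have "x \<in> alg_over (ring_hull F)" using p by (auto simp: alg_over_def polys_over_def)
  then show ?thesis using f by (intro exI[of _ F]) (auto simp: F_def)
qed

lemma poly_altdef_le:
  fixes p :: "'a :: comm_semiring_1 poly"
  shows "degree p \<le> n \<Longrightarrow> poly p x = (\<Sum>i\<le>n. coeff p i * x ^ i)"
  unfolding poly_altdef by (intro sum.mono_neutral_left) (auto simp: coeff_eq_0)

text \<open>Steinitz exchange. A relation for \<open>y\<close> whose coefficients are polynomials in
  \<open>x\<close> is one polynomial in two variables; collecting it by powers of \<open>x\<close>
  instead gives a relation for \<open>x\<close>.\<close>

lemma alg_exchange:
  assumes "subrng R" "y \<in> alg_over (adjoin R x)" "y \<notin> alg_over R"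
  shows "x \<in> alg_over (adjoin R y)"
proof -
  obtain p where p: "p \<in> polys_over (adjoin R x)" "p \<noteq> 0" "poly p y = 0"
    using assms by (auto simp: alg_over_def)
  have "\<forall>j. \<exists>c\<in>polys_over R. coeff p j = poly c x" using p(1) by (auto simp: polys_over_def adjoin_def)
  then obtain c where c: "\<And>j. c j \<in> polys_over R" "\<And>j. coeff p j = poly (c j) x" by metis
  define n where "n = degree p"
  define m where "m = Max ((\<lambda>j. degree (c j)) ` {..n})"
  have m: "degree (c j) \<le> m" if "j \<le> n" for j using that by (auto simp: m_def)
  \<comment> \<open>The polynomial in \<open>y\<close> that multiplies \<open>x ^ i\<close> after
    the regrouping; \<open>m\<close> bounds the powers of \<open>x\<close> that occur.\<close>
  define d where "d i = Poly (map (\<lambda>j. coeff (c j) i) [0..<Suc n])" for i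
  have cd: "coeff (d i) j = (if j \<le> n then coeff (c j) i else 0)" for i j
    by (auto simp: d_def nth_default_def simp del: upt_Suc)
  have d: "d i \<in> polys_over R" for i
    using c(1) subrng_0[OF assms(1)] by (auto simp: polys_over_def cd)
  have evd: "poly (d i) y = (\<Sum>j\<le>n. coeff (c j) i * y ^ j)" for i
    using poly_altdef_le[of "d i" n y] degree_le[of n "d i"] by (simp add: cd)
  define r where "r = Poly (map (\<lambda>i. poly (d i) y) [0..<Suc m])"
  have cr: "coeff r i = (if i \<le> m then poly (d i) y else 0)" for i
    by (auto simp: r_def nth_default_def simp del: upt_Suc)
  have "r \<in> polys_over (adjoin R y)"
    using d subrng_0[OF subrng_adjoin[OF assms(1)]] by (auto simp: polys_over_def cr adjoin_def)
  moreover have "poly r x = 0"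
  proof -
    have "poly r x = (\<Sum>i\<le>m. poly (d i) y * x ^ i)"
      using poly_altdef_le[of r m x] degree_le[of m r] by (simp add: cr)
    also have "\<dots> = (\<Sum>j\<le>n. \<Sum>i\<le>m. coeff (c j) i * y ^ j * x ^ i)"
      unfolding evd sum_distrib_right by (rule sum.swap)
    also have "\<dots> = (\<Sum>j\<le>n. poly (c j) x * y ^ j)"
      using m by (intro sum.cong) (auto simp: poly_altdef_le[of _ m x] sum_distrib_left mult_ac)
    also have "\<dots> = poly p y" by (simp add: poly_altdef c(2) n_def)
    finally show ?thesis using p by simp
  qed
  \<comment> \<open>Transcendence of \<open>y\<close> over \<open>R\<close> enters here: some
    \<open>d i\<close> is a nonzero polynomial because the leading coefficient of \<open>p\<close>
    is nonzero, and \<open>y\<close> is not a root of it.\<close>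
  moreover have "r \<noteq> 0"
  proof
    assume "r = 0"
    have "poly (c n) x \<noteq> 0" using p(2) c(2)[of n] leading_coeff_neq_0 unfolding n_def by metis
    then have "c n \<noteq> 0" by auto
    then obtain i where i: "coeff (c n) i \<noteq> 0" by (auto simp: poly_eq_iff)
    then have "i \<le> m" using m[of n] le_degree[OF i] by simp
    then have "poly (d i) y = 0" using \<open>r = 0\<close> cr[of i] by simp
    moreover have "d i \<noteq> 0" using cd[of i n] i by auto
    ultimately have "y \<in> alg_over R" using d by (auto simp: alg_over_def)
    then show False using assms by simp
  qed
  ultimately show ?thesis by (auto simp: alg_over_def)
qed

section \<open>Algebraic independence and transcendence bases\<close>

definition alg_indep :: "complex set \<Rightarrow> bool" where
  "alg_indep B \<longleftrightarrow> (\<forall>b\<in>B. b \<notin> alg_over (ring_hull (B - {b})))"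

lemma adjoin_hull: "adjoin (ring_hull S) x \<subseteq> ring_hull (insert x S)"
proof
  fix y assume "y \<in> adjoin (ring_hull S) x"
  then obtain p where p: "p \<in> polys_over (ring_hull S)" "y = poly p x" by (auto simp: adjoin_def)
  have pow: "x ^ i \<in> ring_hull (insert x S)" for i
    by (induction i) (auto intro: ring_hull.intros)
  show "y \<in> ring_hull (insert x S)"
    using p ring_hull_mono[of S "insert x S"] unfolding poly_altdef p(2)
    by (intro subrng_sum[OF subrng_ring_hull] ring_hull.mult pow) (auto simp: polys_over_def)
qed

text \<open>Zorn's lemma gives a maximal independent set. A number transcendental over it could be
  added to it: by exchange, a relation for an old element that involves the new one would make the
  new one algebraic.\<close>

lemma ex_transcendence_basis: "\<exists>B. alg_indep B \<and> alg_over (ring_hull B) = UNIV"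
proof -
  have "\<exists>B\<in>{B. alg_indep B}. \<forall>Y\<in>{B. alg_indep B}. B \<subseteq> Y \<longrightarrow> Y = B"
  proof (rule subset_Zorn_nonempty)
    show "{B. alg_indep B} \<noteq> {}" by (auto simp: alg_indep_def)
    fix C assume C: "C \<noteq> {}" "subset.chain {B. alg_indep B} C"
    have "alg_indep (\<Union>C)" unfolding alg_indep_def
    proof (intro ballI notI)
      fix b assume b: "b \<in> \<Union>C" "b \<in> alg_over (ring_hull (\<Union>C - {b}))"
      obtain F where F: "finite F" "F \<subseteq> \<Union>C - {b}" "b \<in> alg_over (ring_hull F)"
        using alg_over_hull_finite[OF b(2)] by auto
      have "finite (insert b F)" "insert b F \<subseteq> \<Union>C" using F b by auto
      then obtain B where B: "B \<in> C" "insert b F \<subseteq> B"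
        using finite_subset_Union_chain[of "insert b F" C "{B. alg_indep B}"] C by auto
      have "b \<in> alg_over (ring_hull (B - {b}))"
        using F B alg_over_mono[OF ring_hull_mono[of F "B - {b}"]] by auto
      moreover have "alg_indep B" using B C by (auto simp: subset.chain_def)
      ultimately show False using B by (auto simp: alg_indep_def)
    qed
    then show "\<Union>C \<in> {B. alg_indep B}" by simp
  qed
  then obtain B where B: "alg_indep B" and max: "\<And>Y. alg_indep Y \<Longrightarrow> B \<subseteq> Y \<Longrightarrow> Y = B" by auto
  have "x \<in> alg_over (ring_hull B)" for x
  proof (rule ccontr)
    assume x: "x \<notin> alg_over (ring_hull B)"
    have "[:-x, 1:] \<in> polys_over (ring_hull B)" if "x \<in> B"
    proof -
      have "0 - x \<in> ring_hull B" using that subrng_0[OF subrng_ring_hull] by (blast intro: ring_hull.intros)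
      then show ?thesis using subrng_0[OF subrng_ring_hull, of B]
        by (auto simp: polys_over_def coeff_pCons ring_hull.one split: nat.splits)
    qed
    then have xB: "x \<notin> B" using x unfolding alg_over_def by force
    have "alg_indep (insert x B)" unfolding alg_indep_def
    proof (intro ballI notI)
      fix b assume b: "b \<in> insert x B" "b \<in> alg_over (ring_hull (insert x B - {b}))"
      show False
      proof (cases "b = x")
        case True
        then show False using b x xB by simp
      next
        case False
        let ?R = "ring_hull (B - {b})"
        have "insert x B - {b} = insert x (B - {b})" using False by auto
        then have "b \<in> alg_over (adjoin ?R x)"
          using b alg_over_mono[OF ring_hull_insert] by auto
        moreover have "b \<notin> alg_over ?R" using B b False by (auto simp: alg_indep_def)
        ultimately have "x \<in> alg_over (adjoin ?R b)" using alg_exchange subrng_ring_hull by blast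
        moreover have "insert b (B - {b}) = B" using b False by auto
        ultimately show False using x alg_over_mono[OF adjoin_hull[of "B - {b}" b]] by auto
      qed
    qed
    then show False using max xB by blast
  qed
  then show ?thesis using B by blast
qed

lemma countable_polys_over: "countable R \<Longrightarrow> countable (polys_over R)"
proof -
  assume R: "countable R"
  have "coeffs ` polys_over R \<subseteq> lists R"
    by (auto simp: polys_over_def coeffs_def)
  then have "countable (coeffs ` polys_over R)"
    using countable_lists[OF R] by (rule countable_subset)
  then show ?thesis
    by (rule countable_image_inj_on) (auto simp: inj_on_def coeffs_eq_iff)
qed

lemma countable_ring_hull:
  assumes "finite S"
  shows "countable (ring_hull S)"
  using assms
proof induction
  case empty
  have "ring_hull {} \<subseteq> \<int>" by (rule ring_hull_least) (auto simp: subrng_def)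
  then show ?case using countable_int by (rule countable_subset)
next
  case (insert x F)
  then have "countable (adjoin (ring_hull F) x)"
    unfolding adjoin_def by (intro countable_image countable_polys_over)
  then show ?case using ring_hull_insert countable_subset by blast
qed

text \<open>A finite set generates a countable ring, over which only countably many numbers are
  algebraic. Infinitude provides a bijection of the basis with a proper subset of it.\<close>

lemma transcendence_basis_infinite:
  assumes "alg_over (ring_hull B) = UNIV"
  shows "infinite B"
proof
  assume "finite B"
  have "alg_over (ring_hull B) = (\<Union>p\<in>polys_over (ring_hull B) - {0}. {x. poly p x = 0})"
    by (auto simp: alg_over_def)
  moreover have "countable \<dots>"
    using countable_polys_over[OF countable_ring_hull[OF \<open>finite B\<close>]]
    by (intro countable_UN) (auto intro: countable_finite poly_roots_finite)
  ultimately show False using assms uncountable_UNIV_complex by simp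
qed

text \<open>
  A partial ring isomorphism is represented by its graph: a subring of \<open>complex \<times> complex\<close> in which
  one component vanishes exactly when the other does.
\<close>

definition pair_ring :: "(complex \<times> complex) set \<Rightarrow> bool" where
  "pair_ring H \<longleftrightarrow> (1, 1) \<in> H \<and>
     (\<forall>(a, b)\<in>H. \<forall>(c, d)\<in>H. (a - c, b - d) \<in> H \<and> (a * c, b * d) \<in> H)"

definition partial_iso :: "(complex \<times> complex) set \<Rightarrow> bool" where
  "partial_iso H \<longleftrightarrow> pair_ring H \<and> (\<forall>(a, b)\<in>H. a = 0 \<longleftrightarrow> b = 0)"

definition pair_polys :: "(complex \<times> complex) set \<Rightarrow> (complex poly \<times> complex poly) set" where
  "pair_polys H = {(p, q). \<forall>i. (coeff p i, coeff q i) \<in> H}"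

definition pair_adjoin :: "(complex \<times> complex) set \<Rightarrow> complex \<Rightarrow> complex \<Rightarrow> (complex \<times> complex) set" where
  "pair_adjoin H x y = (\<lambda>(p, q). (poly p x, poly q y)) ` pair_polys H"

inductive_set pair_hull :: "(complex \<times> complex) set \<Rightarrow> (complex \<times> complex) set" for S where
  one: "(1, 1) \<in> pair_hull S"
| base: "(a, b) \<in> S \<Longrightarrow> (a, b) \<in> pair_hull S"
| diff: "(a, b) \<in> pair_hull S \<Longrightarrow> (c, d) \<in> pair_hull S \<Longrightarrow> (a - c, b - d) \<in> pair_hull S"
| mult: "(a, b) \<in> pair_hull S \<Longrightarrow> (c, d) \<in> pair_hull S \<Longrightarrow> (a * c, b * d) \<in> pair_hull S"

lemma pair_ringD:
  assumes "pair_ring H"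
  shows "(1, 1) \<in> H" "(a, b) \<in> H \<Longrightarrow> (c, d) \<in> H \<Longrightarrow> (a - c, b - d) \<in> H"
    "(a, b) \<in> H \<Longrightarrow> (c, d) \<in> H \<Longrightarrow> (a * c, b * d) \<in> H"
  using assms by (auto simp: pair_ring_def)

lemma pair_ringI:
  assumes "(1, 1) \<in> H"
    and "\<And>a b c d. (a, b) \<in> H \<Longrightarrow> (c, d) \<in> H \<Longrightarrow> (a - c, b - d) \<in> H \<and> (a * c, b * d) \<in> H"
  shows "pair_ring H"
  using assms by (auto simp: pair_ring_def)

lemma pair_ring_0: "pair_ring H \<Longrightarrow> (0, 0) \<in> H"
  using pair_ringD(1)[of H] pair_ringD(2)[of H 1 1 1 1] by simp

lemma pair_ring_add:
  assumes "pair_ring H" "(a, b) \<in> H" "(c, d) \<in> H"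
  shows "(a + c, b + d) \<in> H"
  using pair_ringD(2)[OF assms(1) assms(2) pair_ringD(2)[OF assms(1) pair_ring_0[OF assms(1)] assms(3)]]
  by simp

lemma pair_ring_sum:
  "pair_ring H \<Longrightarrow> (\<And>i. i \<in> A \<Longrightarrow> (f i, g i) \<in> H) \<Longrightarrow> (sum f A, sum g A) \<in> H"
  by (induction A rule: infinite_finite_induct) (auto simp: pair_ring_0 pair_ring_add)

lemma pair_ring_power: "pair_ring H \<Longrightarrow> (a, b) \<in> H \<Longrightarrow> (a ^ n, b ^ n) \<in> H"
  by (induction n) (auto intro: pair_ringD)

lemma pair_ring_pair_hull: "pair_ring (pair_hull S)"
  by (auto simp: pair_ring_def intro: pair_hull.intros)

lemma pair_hull_least:
  assumes "S \<subseteq> H" "pair_ring H"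
  shows "pair_hull S \<subseteq> H"
proof -
  have "(a, b) \<in> H" if "(a, b) \<in> pair_hull S" for a b
    using that by induction (use assms in \<open>auto intro: pair_ringD\<close>)
  then show ?thesis by auto
qed

lemma pair_hull_mono: "S \<subseteq> T \<Longrightarrow> pair_hull S \<subseteq> pair_hull T"
  by (intro pair_hull_least pair_ring_pair_hull) (auto intro: pair_hull.base)

lemma pair_hull_finite:
  assumes "(a, b) \<in> pair_hull S"
  shows "\<exists>F. finite F \<and> F \<subseteq> S \<and> (a, b) \<in> pair_hull F"
  using assms
proof (induction rule: pair_hull.induct)
  case one
  then show ?case by (intro exI[of _ "{}"]) (auto intro: pair_hull.intros)
next
  case (base a b)
  then show ?case by (intro exI[of _ "{(a, b)}"]) (auto intro: pair_hull.intros)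
next
  case (diff a b c d)
  then obtain F F' where "finite F \<and> F \<subseteq> S \<and> (a, b) \<in> pair_hull F" "finite F' \<and> F' \<subseteq> S \<and> (c, d) \<in> pair_hull F'"
    by blast
  then show ?case using pair_hull_mono[of F "F \<union> F'"] pair_hull_mono[of F' "F \<union> F'"]
    by (intro exI[of _ "F \<union> F'"]) (auto intro: pair_hull.intros)
next
  case (mult a b c d)
  then obtain F F' where "finite F \<and> F \<subseteq> S \<and> (a, b) \<in> pair_hull F" "finite F' \<and> F' \<subseteq> S \<and> (c, d) \<in> pair_hull F'"
    by blast
  then show ?case using pair_hull_mono[of F "F \<union> F'"] pair_hull_mono[of F' "F \<union> F'"]
    by (intro exI[of _ "F \<union> F'"]) (auto intro: pair_hull.intros)
qed

lemma pair_hull_proj: "(a, b) \<in> pair_hull S \<Longrightarrow> a \<in> ring_hull (fst ` S) \<and> b \<in> ring_hull (snd ` S)"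
  by (induction rule: pair_hull.induct) (force intro: ring_hull.intros)+

lemma ring_hull_fst_image: "x \<in> ring_hull (fst ` S) \<Longrightarrow> \<exists>y. (x, y) \<in> pair_hull S"
  by (induction rule: ring_hull.induct) (fastforce intro: pair_hull.intros)+

lemma pair_polys_diff:
  assumes "pair_ring H" "(p, q) \<in> pair_polys H" "(p', q') \<in> pair_polys H"
  shows "(p - p', q - q') \<in> pair_polys H"
  using assms by (auto simp: pair_polys_def intro: pair_ringD)

lemma pair_polys_add:
  assumes "pair_ring H" "(p, q) \<in> pair_polys H" "(p', q') \<in> pair_polys H"
  shows "(p + p', q + q') \<in> pair_polys H"
  using assms by (auto simp: pair_polys_def intro: pair_ring_add)

lemma pair_polys_mult:
  assumes "pair_ring H" "(p, q) \<in> pair_polys H" "(p', q') \<in> pair_polys H"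
  shows "(p * p', q * q') \<in> pair_polys H"
  using assms by (auto simp: pair_polys_def coeff_mult intro!: pair_ring_sum intro: pair_ringD)

lemma pair_polys_monom:
  assumes "pair_ring H" "(a, b) \<in> H"
  shows "(monom a n, monom b n) \<in> pair_polys H"
  using assms pair_ring_0 by (auto simp: pair_polys_def)

lemma pair_polys_const:
  assumes "pair_ring H" "(a, b) \<in> H"
  shows "([:a:], [:b:]) \<in> pair_polys H"
  using pair_polys_monom[OF assms, of 0] by (simp add: monom_0)

lemma pair_ring_pair_adjoin:
  assumes "pair_ring H"
  shows "pair_ring (pair_adjoin H x y)"
proof (rule pair_ringI)
  show "(1, 1) \<in> pair_adjoin H x y"
    using pair_polys_const[OF assms pair_ringD(1)[OF assms]] by (force simp: pair_adjoin_def)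
  fix a b c d assume "(a, b) \<in> pair_adjoin H x y" "(c, d) \<in> pair_adjoin H x y"
  then obtain p q p' q' where *: "(p, q) \<in> pair_polys H" "(p', q') \<in> pair_polys H"
    "(a, b) = (poly p x, poly q y)" "(c, d) = (poly p' x, poly q' y)"
    by (auto simp: pair_adjoin_def)
  show "(a - c, b - d) \<in> pair_adjoin H x y \<and> (a * c, b * d) \<in> pair_adjoin H x y"
    using pair_polys_diff[OF assms *(1,2)] pair_polys_mult[OF assms *(1,2)] *(3,4)
    by (force simp: pair_adjoin_def)
qed

lemma pair_adjoin_superset: "pair_ring H \<Longrightarrow> H \<subseteq> pair_adjoin H x y"
  using pair_polys_const by (force simp: pair_adjoin_def)

lemma pair_adjoin_generator: "pair_ring H \<Longrightarrow> (x, y) \<in> pair_adjoin H x y"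
  using pair_polys_monom[of H 1 1 1] pair_ringD(1) by (force simp: pair_adjoin_def poly_monom)

lemma pair_hull_insert: "pair_hull (insert (x, y) S) \<subseteq> pair_adjoin (pair_hull S) x y"
proof (rule pair_hull_least)
  show "insert (x, y) S \<subseteq> pair_adjoin (pair_hull S) x y"
    using pair_adjoin_superset[OF pair_ring_pair_hull, of S x y]
      pair_adjoin_generator[OF pair_ring_pair_hull, of x y S]
    by (auto intro: pair_hull.base)
qed (intro pair_ring_pair_adjoin pair_ring_pair_hull)

lemma partial_isoD: "partial_iso H \<Longrightarrow> pair_ring H" "partial_iso H \<Longrightarrow> (a, b) \<in> H \<Longrightarrow> a = 0 \<longleftrightarrow> b = 0"
  by (auto simp: partial_iso_def)

lemma pair_polys_eq_0:
  "partial_iso H \<Longrightarrow> (p, q) \<in> pair_polys H \<Longrightarrow> p = 0 \<longleftrightarrow> q = 0"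
  by (auto simp: pair_polys_def poly_eq_iff dest: partial_isoD)

lemma pair_polys_degree:
  assumes "partial_iso H" "(p, q) \<in> pair_polys H"
  shows "degree p = degree q"
proof -
  have "coeff p i = 0 \<longleftrightarrow> coeff q i = 0" for i
    using assms by (auto simp: pair_polys_def dest: partial_isoD)
  then show ?thesis by (simp add: degree_def)
qed

lemma alg_indep_subset:
  assumes "alg_indep S" "T \<subseteq> S"
  shows "alg_indep T"
  unfolding alg_indep_def
proof
  fix b assume b: "b \<in> T"
  have "T - {b} \<subseteq> S - {b}" using assms by auto
  from alg_over_mono[OF ring_hull_mono[OF this]] show "b \<notin> alg_over (ring_hull (T - {b}))"
    using assms b by (auto simp: alg_indep_def)
qed

text \<open>Induction on the number of pairs. The new \<open>x\<close> and \<open>y\<close> are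
  transcendental over the rings generated by the components of the other pairs, so corresponding
  polynomials vanish at \<open>x\<close> and \<open>y\<close> only when they are zero, and they are
  zero together.\<close>

lemma partial_iso_pair_hull:
  assumes "finite F"
    and "alg_indep (fst ` F)" "inj_on fst F" "alg_indep (snd ` F)" "inj_on snd F"
  shows "partial_iso (pair_hull F)"
  using assms
proof (induction F)
  case empty
  have "pair_hull {} \<subseteq> Id" by (rule pair_hull_least) (auto simp: pair_ring_def)
  then show ?case using pair_ring_pair_hull by (auto simp: partial_iso_def)
next
  case (insert xy F)
  obtain x y where xy: "xy = (x, y)" by (cases xy)
  have nx: "x \<notin> fst ` F" and ny: "y \<notin> snd ` F"
    using insert.prems(2,4) insert.hyps(2) xy unfolding inj_on_insert by auto
  have IH: "partial_iso (pair_hull F)"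
  proof (rule insert.IH)
    show "alg_indep (fst ` F)" by (rule alg_indep_subset[OF insert.prems(1)]) auto
    show "alg_indep (snd ` F)" by (rule alg_indep_subset[OF insert.prems(3)]) auto
    show "inj_on fst F" "inj_on snd F"
      using insert.prems(2,4) by auto
  qed
  have x: "x \<notin> alg_over (ring_hull (fst ` F))" and y: "y \<notin> alg_over (ring_hull (snd ` F))"
    using insert.prems xy nx ny by (auto simp: alg_indep_def)
  have "poly p x = 0 \<longleftrightarrow> poly q y = 0" if pq: "(p, q) \<in> pair_polys (pair_hull F)" for p q
  proof -
    have "p \<in> polys_over (ring_hull (fst ` F))" "q \<in> polys_over (ring_hull (snd ` F))"
      using pq pair_hull_proj by (auto simp: pair_polys_def polys_over_def)
    then have "poly p x = 0 \<longleftrightarrow> p = 0" "poly q y = 0 \<longleftrightarrow> q = 0"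
      using x y by (auto simp: alg_over_def)
    then show ?thesis using pair_polys_eq_0[OF IH pq] by simp
  qed
  then show ?case
    using pair_hull_insert[of x y F] pair_ring_pair_hull
    by (fastforce simp: partial_iso_def xy pair_adjoin_def)
qed

section \<open>Division with remainder and extension to algebraic elements\<close>

text \<open>A ring does not supply inverses of leading coefficients, so the dividend is multiplied
  by a power of the leading coefficient. Each step is carried out on both components at once, which
  keeps quotients and remainders in correspondence.\<close>

lemma pair_polys_pseudo_division:
  assumes iso: "partial_iso H" and m: "(m, m') \<in> pair_polys H" and p: "(p, p') \<in> pair_polys H"
  shows "\<exists>k u u' r r'. (u, u') \<in> pair_polys H \<and> (r, r') \<in> pair_polys H \<and>
     smult (lead_coeff m ^ k) p = m * u + r \<and> smult (lead_coeff m' ^ k) p' = m' * u' + r' \<and>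
     (r = 0 \<or> degree r < degree m)"
  using p
proof (induction "degree p" arbitrary: p p' rule: less_induct)
  case less
  note H = partial_isoD(1)[OF iso]
  show ?case
  proof (cases "p = 0 \<or> degree p < degree m")
    case True
    show ?thesis
      using less.prems True pair_polys_const[OF H pair_ring_0[OF H]]
      by (intro exI[of _ 0] exI[of _ p] exI[of _ p']) auto
  next
    case False
    have lm: "(lead_coeff m, lead_coeff m') \<in> H" and lp: "(lead_coeff p, lead_coeff p') \<in> H"
      using m less.prems pair_polys_degree[OF iso m] pair_polys_degree[OF iso less.prems]
      by (auto simp: pair_polys_def)
    define w where "w = monom (lead_coeff p) (degree p - degree m)"
    define w' where "w' = monom (lead_coeff p') (degree p - degree m)"
    have w: "(w, w') \<in> pair_polys H" using lp H by (auto simp: w_def w'_def intro: pair_polys_monom)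
    \<comment> \<open>Both terms have the product of the two leading coefficients in degree
      \<open>degree p\<close>, so the difference drops in degree or is zero.\<close>
    define s where "s = [:lead_coeff m:] * p - m * w"
    define s' where "s' = [:lead_coeff m':] * p' - m' * w'"
    have s: "(s, s') \<in> pair_polys H"
      unfolding s_def s'_def using H m(1) w less.prems lm
      by (intro pair_polys_diff pair_polys_mult pair_polys_const)
    show ?thesis
    proof (cases "s = 0")
      case True
      then have "s' = 0" using pair_polys_eq_0[OF iso s] by simp
      then show ?thesis using True w pair_polys_const[OF H pair_ring_0[OF H]]
        by (intro exI[of _ 1] exI[of _ w] exI[of _ w'] exI[of _ 0]) (auto simp: s_def s'_def)
    next
      case False
      have "degree s < degree p"
      proof -
        have "degree w = degree p - degree m" using \<open>\<not> (p = 0 \<or> _)\<close> by (simp add: w_def degree_monom_eq)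
        then have "degree s \<le> degree p"
          unfolding s_def using \<open>\<not> (p = 0 \<or> _)\<close> degree_mult_le[of m w]
          by (intro degree_diff_le) auto
        moreover have "coeff s (degree p) = 0"
          using \<open>\<not> (p = 0 \<or> _)\<close> by (simp add: s_def w_def mult.commute[of m] coeff_monom_mult)
        ultimately show ?thesis
          using False by (metis eq_zero_or_degree_less order_le_less)
      qed
      from less.hyps[OF this s] obtain k u u' r r' where
        *: "(u, u') \<in> pair_polys H" "(r, r') \<in> pair_polys H"
          "smult (lead_coeff m ^ k) s = m * u + r" "smult (lead_coeff m' ^ k) s' = m' * u' + r'"
          "r = 0 \<or> degree r < degree m"
        by blast
      define v where "v = [:lead_coeff m ^ k:] * w + u"
      define v' where "v' = [:lead_coeff m' ^ k:] * w' + u'"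
      have "(v, v') \<in> pair_polys H"
        unfolding v_def v'_def using H w *(1) lm
        by (intro pair_polys_add pair_polys_mult pair_polys_const pair_ring_power)
      moreover have "smult (lead_coeff m ^ Suc k) p = m * v + r"
        using *(3) by (simp add: s_def v_def algebra_simps smult_diff_right)
      moreover have "smult (lead_coeff m' ^ Suc k) p' = m' * v' + r'"
        using *(4) by (simp add: s'_def v'_def algebra_simps smult_diff_right)
      ultimately show ?thesis using * by blast
    qed
  qed
qed

text \<open>Take a nonzero \<open>m\<close> of least degree over the domain that vanishes at
  \<open>x\<close>, and let \<open>y\<close> be a root of its counterpart. Division by
  \<open>m\<close> carries every relation of \<open>x\<close> over to \<open>y\<close>. Minimality
  of degree plays the part of irreducibility.\<close>

lemma partial_iso_extend:
  assumes H: "partial_iso H" and x: "x \<in> alg_over (fst ` H)"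
  shows "\<exists>y. partial_iso (pair_adjoin H x y)"
proof -
  note R = partial_isoD(1)[OF H]
  have deg: "degree q = degree p" if "(p, q) \<in> pair_polys H" for p q
    using pair_polys_degree[OF H that] by simp
  define M where "M = (\<lambda>m. m \<noteq> 0 \<and> poly m x = 0 \<and> (\<exists>m'. (m, m') \<in> pair_polys H))"
  obtain p where p: "p \<in> polys_over (fst ` H)" "p \<noteq> 0" "poly p x = 0"
    using x by (auto simp: alg_over_def)
  have "\<forall>i. \<exists>c. (coeff p i, c) \<in> H" using p(1) by (force simp: polys_over_def)
  then obtain c where c: "\<And>i. (coeff p i, c i) \<in> H" by metis
  define p' where "p' = Poly (map c [0..<Suc (degree p)])"
  have "coeff p' i = c i" for i
    using c[of i] coeff_eq_0[of p i] partial_isoD(2)[OF H, of "coeff p i" "c i"]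
    by (auto simp: p'_def nth_default_def simp del: upt_Suc)
  then have "(p, p') \<in> pair_polys H" using c by (simp add: pair_polys_def)
  then have "M p" using p by (auto simp: M_def)
  define m where "m = arg_min degree M"
  have m: "M m" and min: "\<And>r. M r \<Longrightarrow> degree m \<le> degree r"
    using arg_min_nat_lemma[of M p degree] \<open>M p\<close> by (auto simp: m_def)
  obtain m' where mm: "(m, m') \<in> pair_polys H" "m \<noteq> 0" "poly m x = 0" using m by (auto simp: M_def)
  have "m' \<noteq> 0" using pair_polys_eq_0[OF H mm(1)] mm by simp
  have "degree m \<noteq> 0"
  proof
    assume "degree m = 0"
    then obtain a where "m = [:a:]" by (auto elim: degree_eq_zeroE)
    then show False using mm by simp
  qed
  then have "degree m' \<noteq> 0" using deg[OF mm(1)] by simp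
  then obtain y where y: "poly m' y = 0"
    using fundamental_theorem_of_algebra[of m'] constant_degree[of m'] by auto
  have xy: "poly q' y = 0" if q: "(q, q') \<in> pair_polys H" "poly q x = 0" for q q'
  proof -
    obtain k u u' r r' where *: "(u, u') \<in> pair_polys H" "(r, r') \<in> pair_polys H"
      "smult (lead_coeff m ^ k) q = m * u + r" "smult (lead_coeff m' ^ k) q' = m' * u' + r'"
      "r = 0 \<or> degree r < degree m"
      using pair_polys_pseudo_division[OF H mm(1) q(1)] by blast
    have "poly r x = 0" using arg_cong[OF *(3), of "\<lambda>p. poly p x"] q mm by simp
    then have "\<not> degree r < degree m \<or> r = 0" using *(2) min[of r] unfolding M_def by (meson not_less)
    then have "r = 0" using *(5) by blast
    then have "r' = 0" using pair_polys_eq_0[OF H *(2)] by simp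
    then show ?thesis using arg_cong[OF *(4), of "\<lambda>p. poly p y"] y \<open>m' \<noteq> 0\<close> by simp
  qed
  \<comment> \<open>The converse repeats the division argument from the side of \<open>y\<close>. It
    works once the least-degree polynomial \<open>n\<close> whose counterpart kills \<open>y\<close>
    is known to vanish at \<open>x\<close>.\<close>
  define N where "N = (\<lambda>n. n \<noteq> 0 \<and> (\<exists>n'. (n, n') \<in> pair_polys H \<and> poly n' y = 0))"
  define n where "n = arg_min degree N"
  have "N m" using mm y by (auto simp: N_def)
  then have n: "N n" and nmin: "\<And>r. N r \<Longrightarrow> degree n \<le> degree r"
    using arg_min_nat_lemma[of N m degree] by (auto simp: n_def)
  obtain n' where nn: "(n, n') \<in> pair_polys H" "n \<noteq> 0" "poly n' y = 0" using n by (auto simp: N_def)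
  have div: "\<exists>k u. u \<in> fst ` pair_polys H \<and> smult (lead_coeff n ^ k) q = n * u"
    if q: "(q, q') \<in> pair_polys H" "poly q' y = 0" for q q'
  proof -
    obtain k u u' r r' where *: "(u, u') \<in> pair_polys H" "(r, r') \<in> pair_polys H"
      "smult (lead_coeff n ^ k) q = n * u + r" "smult (lead_coeff n' ^ k) q' = n' * u' + r'"
      "r = 0 \<or> degree r < degree n"
      using pair_polys_pseudo_division[OF H nn(1) q(1)] by blast
    have "poly r' y = 0" using arg_cong[OF *(4), of "\<lambda>p. poly p y"] q nn by simp
    then have "\<not> degree r < degree n \<or> r = 0" using *(2) nmin[of r] unfolding N_def by (meson not_less)
    then have "r = 0" using *(5) by blast
    then show ?thesis using * by force
  qed
  \<comment> \<open>Otherwise \<open>x\<close> is a root of the cofactor of \<open>n\<close> in a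
    scalar multiple of \<open>m\<close>. By minimality of \<open>m\<close> that leaves
    \<open>n\<close> constant, although its nonzero counterpart has the root
    \<open>y\<close>.\<close>
  have "poly n x = 0"
  proof (rule ccontr)
    assume nx: "poly n x \<noteq> 0"
    obtain k u u' where u: "(u, u') \<in> pair_polys H" "smult (lead_coeff n ^ k) m = n * u"
      using div[OF mm(1) y] by force
    have "poly u x = 0" using arg_cong[OF u(2), of "\<lambda>p. poly p x"] mm nx by simp
    moreover have "u \<noteq> 0" using u mm nn by auto
    ultimately have "M u" using u by (auto simp: M_def)
    then have "degree m \<le> degree u" by (rule min)
    moreover have "degree m = degree n + degree u"
      using arg_cong[OF u(2), of degree] nn \<open>u \<noteq> 0\<close> by (simp add: degree_mult_eq)
    ultimately have "degree n' = 0" using deg[OF nn(1)] by simp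
    then obtain a where "n' = [:a:]" by (auto elim: degree_eq_zeroE)
    then show False using nn pair_polys_eq_0[OF H nn(1)] by simp
  qed
  have "poly q x = 0" if q: "(q, q') \<in> pair_polys H" "poly q' y = 0" for q q'
  proof -
    obtain k u where "smult (lead_coeff n ^ k) q = n * u" using div[OF q] by blast
    from arg_cong[OF this, of "\<lambda>p. poly p x"] show ?thesis using nn \<open>poly n x = 0\<close> by simp
  qed
  then have "partial_iso (pair_adjoin H x y)"
    using xy pair_ring_pair_adjoin[OF R, of x y] by (auto simp: partial_iso_def pair_adjoin_def)
  then show ?thesis by blast
qed

section \<open>Total extensions and a nonsurjective endomorphism\<close>

text \<open>Directed families cover both the chains in Zorn's lemma and the hulls of finite subsets
  of a given set of pairs.\<close>

lemma partial_iso_Union: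
  assumes "C \<noteq> {}" "\<And>H. H \<in> C \<Longrightarrow> partial_iso H"
    and dir: "\<And>H K. H \<in> C \<Longrightarrow> K \<in> C \<Longrightarrow> \<exists>L\<in>C. H \<union> K \<subseteq> L"
  shows "partial_iso (\<Union>C)"
proof -
  have "(a - c, b - d) \<in> \<Union>C \<and> (a * c, b * d) \<in> \<Union>C" if ab: "(a, b) \<in> \<Union>C" and cd: "(c, d) \<in> \<Union>C" for a b c d
  proof -
    obtain H K where "H \<in> C" "K \<in> C" "(a, b) \<in> H" "(c, d) \<in> K" using ab cd by blast
    then obtain L where L: "L \<in> C" "(a, b) \<in> L" "(c, d) \<in> L" using dir by blast
    then have "pair_ring L" using assms(2) partial_isoD by blast
    then show ?thesis using L pair_ringD by blast
  qed
  moreover have "(1, 1) \<in> \<Union>C" using assms(1,2) partial_isoD(1) pair_ringD(1) by blast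
  moreover have "a = 0 \<longleftrightarrow> b = 0" if "(a, b) \<in> \<Union>C" for a b
    using that assms(2) partial_isoD(2) by blast
  ultimately show ?thesis unfolding partial_iso_def by (intro conjI pair_ringI) blast+
qed

text \<open>Every number is algebraic over the domain of a maximal extension and can be adjoined, so
  it is already there. Nothing forces the second components to exhaust \<complex>, which leaves room
  for nonsurjectivity.\<close>

lemma ex_total_partial_iso:
  assumes H0: "partial_iso H0" and alg: "alg_over (fst ` H0) = UNIV"
  shows "\<exists>H. partial_iso H \<and> H0 \<subseteq> H \<and> fst ` H = UNIV"
proof -
  let ?A = "{H. partial_iso H \<and> H0 \<subseteq> H}"
  have "\<exists>M\<in>?A. \<forall>K\<in>?A. M \<subseteq> K \<longrightarrow> K = M"
  proof (rule subset_Zorn_nonempty)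
    show "?A \<noteq> {}" using H0 by auto
    fix C assume C: "C \<noteq> {}" "subset.chain ?A C"
    have "partial_iso (\<Union>C)"
    proof (rule partial_iso_Union)
      fix H K assume "H \<in> C" "K \<in> C"
      moreover from this have "H \<subseteq> K \<or> K \<subseteq> H" using C by (auto simp: subset_chain_def)
      ultimately show "\<exists>L\<in>C. H \<union> K \<subseteq> L" by (meson Un_least order_refl)
    next
      show "C \<noteq> {}" by (rule C)
      show "partial_iso H" if "H \<in> C" for H using C that by (auto simp: subset_chain_def)
    qed
    moreover have "H0 \<subseteq> \<Union>C" using C unfolding subset_chain_def by blast
    ultimately show "\<Union>C \<in> ?A" by simp
  qed
  then obtain H where H: "partial_iso H" "H0 \<subseteq> H" and max: "\<And>K. partial_iso K \<Longrightarrow> H0 \<subseteq> K \<Longrightarrow> H \<subseteq> K \<Longrightarrow> K = H"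
    by auto
  have "x \<in> fst ` H" for x
  proof -
    have "x \<in> alg_over (fst ` H)" using alg alg_over_mono[of "fst ` H0" "fst ` H"] H by auto
    then obtain y where y: "partial_iso (pair_adjoin H x y)" using partial_iso_extend H by blast
    have "pair_adjoin H x y = H"
      using y H pair_adjoin_superset partial_isoD(1) by (intro max) blast+
    then show ?thesis using pair_adjoin_generator[OF partial_isoD(1)[OF H(1)], of x y] by force
  qed
  then show ?thesis using H by blast
qed

text \<open>
  The endomorphism \<open>\<phi>\<close> maps a transcendence basis \<open>B\<close> into \<open>B - {\<tau>}\<close>. Its image is algebraically
  closed, so if \<open>\<tau>\<close> were algebraic over the image it would lie in it, hence be algebraic over
  \<open>B - {\<tau>}\<close>.
\<close>

lemma ex_nonsurjective_endomorphism:
  "\<exists>(\<phi> :: complex \<Rightarrow> complex) \<tau>. \<phi> 1 = 1 \<and> (\<forall>x y. \<phi> (x - y) = \<phi> x - \<phi> y) \<and>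
     (\<forall>x y. \<phi> (x * y) = \<phi> x * \<phi> y) \<and> (\<forall>x. \<phi> x = 0 \<longrightarrow> x = 0) \<and> \<tau> \<notin> alg_over (range \<phi>)"
proof -
  obtain B where B: "alg_indep B" "alg_over (ring_hull B) = UNIV" using ex_transcendence_basis by blast
  have "infinite B" using transcendence_basis_infinite B by blast
  then obtain \<tau> where \<tau>: "\<tau> \<in> B" by fastforce
  obtain h where h: "bij_betw h B (B - {\<tau>})" using infinite_imp_bij_betw[OF \<open>infinite B\<close>] by blast
  define P where "P = (\<lambda>b. (b, h b)) ` B"
  have fstP: "fst ` P = B" and sndP: "snd ` P = B - {\<tau>}"
    using h by (auto simp: P_def image_image bij_betw_def)
  have fin: "partial_iso (pair_hull F)" if "finite F" "F \<subseteq> P" for F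
  proof (rule partial_iso_pair_hull[OF that(1)])
    have "fst ` F \<subseteq> B" "snd ` F \<subseteq> B"
      using image_mono[OF that(2), of fst] image_mono[OF that(2), of snd] unfolding fstP sndP by blast+
    then show "alg_indep (fst ` F)" "alg_indep (snd ` F)"
      using alg_indep_subset[OF B(1)] by blast+
    have "inj_on fst P" "inj_on snd P" using h by (auto simp: P_def inj_on_def bij_betw_def)
    then show "inj_on fst F" "inj_on snd F" using that(2) inj_on_subset by blast+
  qed
  define H0 where "H0 = pair_hull P"
  have "H0 = \<Union> (pair_hull ` {F. finite F \<and> F \<subseteq> P})"
  proof
    show "H0 \<subseteq> \<Union> (pair_hull ` {F. finite F \<and> F \<subseteq> P})"
      using pair_hull_finite[of _ _ P] by (auto simp: H0_def)
    show "\<Union> (pair_hull ` {F. finite F \<and> F \<subseteq> P}) \<subseteq> H0"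
      using pair_hull_mono[of _ P] by (auto simp: H0_def)
  qed
  moreover have "partial_iso \<dots>"
  proof (rule partial_iso_Union)
    show "pair_hull ` {F. finite F \<and> F \<subseteq> P} \<noteq> {}" by auto
    show "partial_iso H" if "H \<in> pair_hull ` {F. finite F \<and> F \<subseteq> P}" for H using that fin by auto
    fix H K assume "H \<in> pair_hull ` {F. finite F \<and> F \<subseteq> P}" "K \<in> pair_hull ` {F. finite F \<and> F \<subseteq> P}"
    then obtain F F' where F: "finite F" "F \<subseteq> P" "finite F'" "F' \<subseteq> P" "H = pair_hull F" "K = pair_hull F'" by auto
    then show "\<exists>L\<in>pair_hull ` {F. finite F \<and> F \<subseteq> P}. H \<union> K \<subseteq> L"
      using pair_hull_mono[of F "F \<union> F'"] pair_hull_mono[of F' "F \<union> F'"]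
      by (intro bexI[of _ "pair_hull (F \<union> F')"]) auto
  qed
  ultimately have H0: "partial_iso H0" by simp
  have "ring_hull B \<subseteq> fst ` H0" using ring_hull_fst_image[of _ P] by (force simp: fstP H0_def)
  then have "alg_over (fst ` H0) = UNIV" using B(2) alg_over_mono[of "ring_hull B" "fst ` H0"] by auto
  then obtain H where H: "partial_iso H" "H0 \<subseteq> H" "fst ` H = UNIV" using ex_total_partial_iso[OF H0] by metis
  note R = partial_isoD(1)[OF H(1)]
  have "\<forall>x. \<exists>y. (x, y) \<in> H" 
  proof
    fix x
    have "x \<in> fst ` H" using H(3) by simp
    then show "\<exists>y. (x, y) \<in> H" by force
  qed
  then obtain \<phi> where \<phi>: "\<And>x. (x, \<phi> x) \<in> H" by metis
  have uniq: "y = \<phi> x" if "(x, y) \<in> H" for x y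
    using pair_ringD(2)[OF R that \<phi>[of x]] partial_isoD(2)[OF H(1), of "x - x" "y - \<phi> x"] by simp
  have 1: "\<phi> 1 = 1" using uniq pair_ringD(1)[OF R] by fastforce
  have diff: "\<phi> (x - y) = \<phi> x - \<phi> y" for x y using uniq[OF pair_ringD(2)[OF R \<phi> \<phi>]] by simp
  have mult: "\<phi> (x * y) = \<phi> x * \<phi> y" for x y using uniq[OF pair_ringD(3)[OF R \<phi> \<phi>]] by simp
  have zero: "x = 0" if "\<phi> x = 0" for x using partial_isoD(2)[OF H(1) \<phi>[of x]] that by simp
  have phi0: "\<phi> 0 = 0" using diff[of 0 0] by simp
  have phi_add: "\<phi> (x + y) = \<phi> x + \<phi> y" for x y
    using diff[of x "- y"] diff[of 0 y] phi0 by simp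
  \<comment> \<open>Over \<complex> the polynomial \<open>p\<close> splits into linear factors, and
    \<open>\<phi>\<close> maps these to linear factors with roots in the range. A root of the image
    polynomial is therefore the image of a root of \<open>p\<close>.\<close>
  have root: "\<tau> \<in> range \<phi>" if "p \<noteq> 0" "poly (map_poly \<phi> p) \<tau> = 0" for p
    using that
  proof (induction "degree p" arbitrary: p)
    case 0
    then obtain a where "p = [:a:]" using degree_eq_zeroE[of p] by metis
    then show ?case using 0 zero phi0 by (auto simp: map_poly_pCons)
  next
    case (Suc d)
    then obtain z where z: "poly p z = 0"
      using fundamental_theorem_of_algebra[of p] constant_degree[of p] by auto
    then obtain q where q: "p = [:-z, 1:] * q" by (metis dvdE poly_eq_0_iff_dvd)
    have "map_poly \<phi> p = [:- \<phi> z, 1:] * map_poly \<phi> q"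
      using diff[of 0 z] phi0
      by (intro poly_eqI) (auto simp: q coeff_map_poly coeff_pCons phi_add mult diff split: nat.splits)
    then have "\<tau> = \<phi> z \<or> poly (map_poly \<phi> q) \<tau> = 0" using Suc.prems by auto
    moreover have "q \<noteq> 0" using Suc.prems q by auto
    moreover have "d = degree q" using Suc.hyps(2) \<open>q \<noteq> 0\<close> unfolding q by (subst (asm) degree_mult_eq) auto
    ultimately show ?case using Suc.hyps(1)[of q] by auto
  qed
  have "\<tau> \<notin> range \<phi>"
  proof
    assume "\<tau> \<in> range \<phi>"
    then obtain x where x: "\<tau> = \<phi> x" by auto
    obtain p where p: "p \<in> polys_over (ring_hull B)" "p \<noteq> 0" "poly p x = 0"
      using B by (auto simp: alg_over_def)
    \<comment> \<open>\<open>H0\<close> pairs elements generated by \<open>B\<close> with elements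
      generated by \<open>B - {\<tau>}\<close>, and \<open>\<phi>\<close> extends
      \<open>H0\<close>.\<close>
    have "\<phi> a \<in> ring_hull (B - {\<tau>})" if a: "a \<in> ring_hull B" for a
    proof -
      obtain b where b: "(a, b) \<in> H0" using ring_hull_fst_image[of a P] a fstP by (auto simp: H0_def)
      then have "b = \<phi> a" using uniq H by auto
      then show ?thesis using pair_hull_proj[of a b P] b sndP by (simp add: H0_def)
    qed
    then have "map_poly \<phi> p \<in> polys_over (ring_hull (B - {\<tau>}))"
      using p(1) phi0 by (auto simp: polys_over_def coeff_map_poly)
    moreover have "map_poly \<phi> p \<noteq> 0"
      using p(2) zero phi0 by (auto simp: poly_eq_iff coeff_map_poly)
    moreover have "poly (map_poly \<phi> p) \<tau> = 0"
    proof -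
      have "poly (map_poly \<phi> q) (\<phi> x) = \<phi> (poly q x)" for q
        using phi0 by (induction q) (auto simp: map_poly_pCons phi_add mult)
      then show ?thesis using p phi0 x by simp
    qed
    ultimately have "\<tau> \<in> alg_over (ring_hull (B - {\<tau>}))" by (auto simp: alg_over_def)
    then show False using B \<tau> by (auto simp: alg_indep_def)
  qed
  moreover have "\<tau> \<in> range \<phi>" if alg: "\<tau> \<in> alg_over (range \<phi>)"
  proof -
    obtain q where q: "q \<in> polys_over (range \<phi>)" "q \<noteq> 0" "poly q \<tau> = 0" using alg by (auto simp: alg_over_def)
    define p where "p = map_poly (inv_into UNIV \<phi>) q"
    have inv: "\<phi> (inv_into UNIV \<phi> (coeff q i)) = coeff q i" for i
      using q(1) by (auto simp: polys_over_def f_inv_into_f)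
    have "inv_into UNIV \<phi> 0 = 0" using phi0 zero by (metis f_inv_into_f rangeI)
    then have "map_poly \<phi> p = q"
      using phi0 inv by (intro poly_eqI) (simp add: p_def coeff_map_poly)
    moreover have "p \<noteq> 0" using q(2) \<open>map_poly \<phi> p = q\<close> by auto
    ultimately show ?thesis using root q by blast
  qed
  ultimately show ?thesis using 1 diff mult zero by blast
qed

text \<open>Apply \<open>\<phi>\<close> to the coefficients and put \<open>\<tau>\<close> for the
  variable. A nonzero polynomial has nonzero value, as \<open>\<tau>\<close> is transcendental over
  the range of \<open>\<phi>\<close>.\<close>

lemma ex_poly_ring_embedding:
  "\<exists>\<psi> :: complex poly \<Rightarrow> complex. inj_comm_ring_hom \<psi>"
proof -
  obtain \<phi> :: "complex \<Rightarrow> complex" and \<tau> where \<phi>: "\<phi> 1 = 1" "\<And>x y. \<phi> (x - y) = \<phi> x - \<phi> y"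
    "\<And>x y. \<phi> (x * y) = \<phi> x * \<phi> y" "\<And>x. \<phi> x = 0 \<Longrightarrow> x = 0" "\<tau> \<notin> alg_over (range \<phi>)"
    using ex_nonsurjective_endomorphism by blast
  have 0: "\<phi> 0 = 0" using \<phi>(2)[of 0 0] by simp
  have add: "\<phi> (x + y) = \<phi> x + \<phi> y" for x y
    using \<phi>(2)[of x "- y"] \<phi>(2)[of 0 y] 0 by simp
  have sum: "\<phi> (sum f A) = (\<Sum>i\<in>A. \<phi> (f i))" for f :: "nat \<Rightarrow> complex" and A
    by (induction A rule: infinite_finite_induct) (auto simp: 0 add)
  have madd: "map_poly \<phi> (p + q) = map_poly \<phi> p + map_poly \<phi> q" for p q
    using 0 add by (intro poly_eqI) (simp add: coeff_map_poly)
  have mmult: "map_poly \<phi> (p * q) = map_poly \<phi> p * map_poly \<phi> q" for p q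
    using 0 sum \<phi>(3) by (intro poly_eqI) (simp add: coeff_map_poly coeff_mult)
  have "p = 0" if "poly (map_poly \<phi> p) \<tau> = 0" for p
  proof -
    have "map_poly \<phi> p \<in> polys_over (range \<phi>)" using 0 by (auto simp: polys_over_def coeff_map_poly)
    then have "map_poly \<phi> p = 0" using \<phi>(5) that by (auto simp: alg_over_def)
    then show ?thesis using \<phi>(4) 0 by (auto simp: poly_eq_iff coeff_map_poly)
  qed
  then have "inj_comm_ring_hom (\<lambda>p. poly (map_poly \<phi> p) \<tau>)"
    by unfold_locales (auto simp: madd mmult \<phi>(1) 0)
  then show ?thesis by blast
qed

section \<open>Representations with positive coefficients\<close>

text \<open>Indexing entries by an arbitrary finite set lets direct sums and tensor products act
  directly on index sets, with no renumbering of basis vectors.\<close>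

definition mat_rep :: "('a, 'b) monoid_scheme \<Rightarrow> 'i set \<Rightarrow> ('a \<Rightarrow> 'i \<Rightarrow> 'i \<Rightarrow> complex) \<Rightarrow> bool" where
  "mat_rep G J R \<longleftrightarrow> finite J \<and>
     (\<forall>g\<in>carrier G. \<forall>h\<in>carrier G. \<forall>i\<in>J. \<forall>j\<in>J. R (g \<otimes>\<^bsub>G\<^esub> h) i j = (\<Sum>k\<in>J. R g i k * R h k j)) \<and>
     (\<forall>i\<in>J. \<forall>j\<in>J. R \<one>\<^bsub>G\<^esub> i j = (if i = j then 1 else 0))"

lemma mat_repD:
  assumes "mat_rep G J R"
  shows "finite J"
    and "g \<in> carrier G \<Longrightarrow> h \<in> carrier G \<Longrightarrow> i \<in> J \<Longrightarrow> j \<in> J \<Longrightarrow>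
      R (g \<otimes>\<^bsub>G\<^esub> h) i j = (\<Sum>k\<in>J. R g i k * R h k j)"
    and "i \<in> J \<Longrightarrow> j \<in> J \<Longrightarrow> R \<one>\<^bsub>G\<^esub> i j = (if i = j then 1 else 0)"
  using assms by (auto simp: mat_rep_def)

lemma mat_rep_cnj:
  assumes "mat_rep G J R"
  shows "mat_rep G J (\<lambda>g i j. cnj (R g i j))"
  using assms by (auto simp: mat_rep_def)

lemma mat_rep_trivial:
  assumes "finite J"
  shows "mat_rep G J (\<lambda>_ i j. if i = j then 1 else 0)"
proof -
  have "(\<Sum>k\<in>J. (if i = k then 1 else 0) * (if k = j then 1 else 0)) = (if i = j then 1 else 0 :: complex)"
    if "i \<in> J" for i j
  proof -
    have "(\<Sum>k\<in>J. (if i = k then 1 else 0) * (if k = j then 1 else 0)) =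
        (\<Sum>k\<in>J. if i = k then if i = j then 1 else 0 else 0 :: complex)"
      by (intro sum.cong) auto
    then show ?thesis using that assms by simp
  qed
  then show ?thesis using assms by (simp add: mat_rep_def)
qed

lemma mat_rep_tensor:
  assumes "mat_rep G J R" "mat_rep G K S"
  shows "mat_rep G (J \<times> K) (\<lambda>g x y. case x of (i, k) \<Rightarrow> case y of (i', k') \<Rightarrow> R g i i' * S g k k')"
  using assms
  by (auto simp: mat_rep_def sum_product sum.cartesian_product intro!: sum.cong)

text \<open>The extra trivial line supplies the constant 1, which makes an entry minus a Kronecker
  delta a matrix coefficient.\<close>

lemma mat_rep_add_trivial:
  assumes "mat_rep G J R"
  shows "mat_rep G (insert None (Some ` J))
    (\<lambda>g i j. case i of None \<Rightarrow> (if j = None then 1 else 0)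
       | Some i' \<Rightarrow> (case j of None \<Rightarrow> 0 | Some j' \<Rightarrow> R g i' j'))"
  using assms by (auto simp: mat_rep_def sum.reindex sum.insert)

text \<open>A squared modulus is \<open>\<Lambda> s g\<close> times its conjugate, hence a matrix
  coefficient of \<open>\<sigma>\<close> tensored with its conjugate. The sum over \<open>s\<close>
  is absorbed into one functional, the sum of all \<open>l s\<close> tensored with their
  conjugates.\<close>

lemma mat_rep_gram:
  fixes l :: "'s \<Rightarrow> 'i \<Rightarrow> complex" and z :: "'i \<Rightarrow> complex"
  assumes \<sigma>: "mat_rep G K \<sigma>"
    and \<Lambda>: "\<And>s g. \<Lambda> s g = (\<Sum>a\<in>K. \<Sum>c\<in>K. l s a * \<sigma> g a c * z c)"
  shows "(\<Sum>x\<in>K \<times> K. \<Sum>y\<in>K \<times> K. (case x of (a, b) \<Rightarrow> \<Sum>s\<in>S. l s a * cnj (l s b)) *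
      (case x of (a, b) \<Rightarrow> case y of (c, d) \<Rightarrow> \<sigma> g a c * cnj (\<sigma> g b d)) *
      (case y of (c, d) \<Rightarrow> z c * cnj (z d))) = of_real (\<Sum>s\<in>S. (cmod (\<Lambda> s g))\<^sup>2)"
proof -
  define f where "f s a c = l s a * \<sigma> g a c * z c" for s a c
  have "of_real (\<Sum>s\<in>S. (cmod (\<Lambda> s g))\<^sup>2) = (\<Sum>s\<in>S. \<Lambda> s g * cnj (\<Lambda> s g))"
    by (simp only: of_real_sum complex_norm_square)
  also have "\<dots> = (\<Sum>s\<in>S. \<Sum>a\<in>K. \<Sum>b\<in>K. \<Sum>c\<in>K. \<Sum>d\<in>K. f s a c * cnj (f s b d))"
    unfolding \<Lambda> by (simp add: f_def sum_product)
  also have "\<dots> = (\<Sum>a\<in>K. \<Sum>b\<in>K. \<Sum>c\<in>K. \<Sum>d\<in>K. \<Sum>s\<in>S. f s a c * cnj (f s b d))"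
    by (simp only: sum.swap[of _ S])
  also have "\<dots> = (\<Sum>a\<in>K. \<Sum>b\<in>K. \<Sum>c\<in>K. \<Sum>d\<in>K. (\<Sum>s\<in>S. l s a * cnj (l s b)) * (\<sigma> g a c * cnj (\<sigma> g b d)) * (z c * cnj (z d)))"
    unfolding sum_distrib_right f_def by (intro sum.cong) (simp_all add: mult_ac)
  finally show ?thesis
    by (simp add: sum.cartesian_product')
qed

text \<open>One type serves all vertex groups, whatever their dimensions, so that the
  representations can be chosen as functions of the vertex. Each factor indexes n copies of the
  given representation and one trivial line.\<close>

type_synonym rep_index = "(nat \<times> nat) option \<times> (nat \<times> nat) option"

text \<open>
  The positive quantity is \<open>\<Sum>\<bar>g i j - \<delta> i j\<bar>\<^sup>2\<close>, a matrix coefficient of the tensor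
  square of \<open>g \<oplus> 1\<close> with its complex conjugate.
\<close>

lemma linear_positive_coefficient:
  assumes "linear_over_complex G"
  shows "\<exists>(J :: rep_index set) R q p. mat_rep G J R \<and>
    (\<forall>g\<in>carrier G. g \<noteq> \<one>\<^bsub>G\<^esub> \<longrightarrow> (\<exists>r>0. (\<Sum>i\<in>J. \<Sum>j\<in>J. q i * R g i j * p j) - (\<Sum>i\<in>J. q i * p i) = of_real r))"
proof -
  obtain n H \<theta> where n: "n \<ge> 1" "subgroup H (GL n)" "\<theta> \<in> iso G (GL n\<lparr>carrier := H\<rparr>)" and G: "group G"
    using assms by (auto simp: linear_over_complex_def is_iso_def)
  interpret G: group G by (rule G)
  interpret L: group "GL n" by (rule group_GL)
  have hom: "\<theta> g \<in> carrier (GL n)" if "g \<in> carrier G" for g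
    using n that subgroup.subset[OF n(2)] by (auto simp: iso_def hom_def)
  have mult: "\<theta> (g \<otimes>\<^bsub>G\<^esub> h) = \<theta> g * \<theta> h" if "g \<in> carrier G" "h \<in> carrier G" for g h
    using n that by (auto simp: iso_def hom_def GL_def units_of_def ring_mat_simps)
  have cm: "\<theta> g \<in> carrier_mat n n" if "g \<in> carrier G" for g
    using hom[OF that] by (simp add: carrier_GL)
  have "\<theta> \<in> hom G (GL n)"
    using n hom by (auto simp: iso_def hom_def)
  then have "\<theta> \<one>\<^bsub>G\<^esub> = \<one>\<^bsub>GL n\<^esub>"
    by (rule hom_one) unfold_locales
  then have one: "\<theta> \<one>\<^bsub>G\<^esub> = 1\<^sub>m n"
    by (simp add: GL_def units_of_def ring_mat_simps)
  have inj: "inj_on \<theta> (carrier G)" using n by (auto simp: iso_def bij_betw_def)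
  define I where "I = {..<n}"
  have "mat_rep G I (\<lambda>g i j. \<theta> g $$ (i, j))"
    unfolding mat_rep_def
  proof (intro conjI ballI)
    fix g h i j assume *: "g \<in> carrier G" "h \<in> carrier G" "i \<in> I" "j \<in> I"
    show "\<theta> (g \<otimes>\<^bsub>G\<^esub> h) $$ (i, j) = (\<Sum>k\<in>I. \<theta> g $$ (i, k) * \<theta> h $$ (k, j))"
      using * cm[OF *(1)] cm[OF *(2)]
      by (auto simp: mult I_def scalar_prod_def atLeast0LessThan intro!: sum.cong)
  qed (auto simp: one I_def)
  \<comment> \<open>Tensoring with a trivial representation of dimension \<open>n\<close> gives
    \<open>n\<close> copies of \<open>\<theta>\<close>. One vector can then stand for the identity
    matrix, and its image lists all entries of \<open>\<theta> g\<close>.\<close>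
  from mat_rep_add_trivial[OF mat_rep_tensor[OF this mat_rep_trivial[of I]]]
  have "mat_rep G (insert None (Some ` (I \<times> I))) (\<lambda>g i j. case i of None \<Rightarrow> (if j = None then 1 else 0)
       | Some i' \<Rightarrow> (case j of None \<Rightarrow> 0 | Some j' \<Rightarrow> (case i' of (i, k) \<Rightarrow> case j' of (i', k') \<Rightarrow> \<theta> g $$ (i, i') * (if k = k' then 1 else 0))))"
    (is "mat_rep G ?K ?\<sigma>") by (simp add: I_def)
  then obtain K \<sigma> where \<sigma>: "mat_rep G K \<sigma>" and K: "K = ?K" and \<sigma>_def: "\<sigma> = ?\<sigma>" by blast
  define z :: "(nat \<times> nat) option \<Rightarrow> complex" where
    "z k = (case k of None \<Rightarrow> 1 | Some (i, j) \<Rightarrow> if i = j then 1 else 0)" for k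
  \<comment> \<open>Reads entry \<open>s\<close> of the matrix and subtracts the Kronecker delta by
    means of the trivial line.\<close>
  define l :: "nat \<times> nat \<Rightarrow> (nat \<times> nat) option \<Rightarrow> complex" where
    "l s k = (case k of None \<Rightarrow> - (if fst s = snd s then 1 else 0) | Some t \<Rightarrow> if s = t then 1 else 0)" for s k
  have uz: "(\<Sum>c\<in>K. \<sigma> g a c * z c) = (case a of None \<Rightarrow> 1 | Some (i, j) \<Rightarrow> \<theta> g $$ (i, j))" if a: "a \<in> K" for g a
  proof (cases a)
    case None
    then show ?thesis by (simp add: K \<sigma>_def z_def sum.reindex I_def)
  next
    case (Some ij)
    then obtain i j where ij: "a = Some (i, j)" "i \<in> I" "j \<in> I" using a by (auto simp: K)
    have "(\<Sum>c\<in>K. \<sigma> g a c * z c) = (\<Sum>t\<in>I \<times> I. \<sigma> g a (Some t) * z (Some t))"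
      using ij by (simp add: K \<sigma>_def sum.reindex I_def)
    also have "\<dots> = (\<Sum>t\<in>I \<times> I. if t = (j, j) then \<theta> g $$ (i, j) else 0)"
      using ij by (intro sum.cong) (auto simp: \<sigma>_def z_def split: if_splits)
    also have "\<dots> = \<theta> g $$ (i, j)" using ij by (simp add: I_def)
    finally show ?thesis using ij by simp
  qed
  define \<Lambda> where "\<Lambda> s g = (\<Sum>a\<in>K. \<Sum>c\<in>K. l s a * \<sigma> g a c * z c)" for s g
  have \<Lambda>: "\<Lambda> (i, j) g = \<theta> g $$ (i, j) - (if i = j then 1 else 0)" if "i \<in> I" "j \<in> I" for i j g
  proof -
    have "\<Lambda> (i, j) g = (\<Sum>a\<in>K. l (i, j) a * (\<Sum>c\<in>K. \<sigma> g a c * z c))"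
      by (simp add: \<Lambda>_def sum_distrib_left mult.assoc)
    also have "\<dots> = (\<Sum>a\<in>K. l (i, j) a * (case a of None \<Rightarrow> 1 | Some (i, j) \<Rightarrow> \<theta> g $$ (i, j)))"
      by (intro sum.cong) (auto simp: uz)
    also have "\<dots> = \<theta> g $$ (i, j) - (if i = j then 1 else 0)"
      using that by (auto simp: K l_def sum.reindex I_def if_distrib[of "\<lambda>x. x * _"] sum.delta cong: if_cong)
    finally show ?thesis .
  qed
  define R where "R g x y = (case x of (a, b) \<Rightarrow> case y of (c, d) \<Rightarrow> \<sigma> g a c * cnj (\<sigma> g b d))" for g x y
  define q where "q x = (case x of (a, b) \<Rightarrow> \<Sum>s\<in>I \<times> I. l s a * cnj (l s b))" for x
  define p where "p y = (case y of (c, d) \<Rightarrow> z c * cnj (z d))" for y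
  have R: "mat_rep G (K \<times> K) R"
    using mat_rep_tensor[OF \<sigma> mat_rep_cnj[OF \<sigma>]] by (simp add: R_def[abs_def])
  have eq: "(\<Sum>i\<in>K \<times> K. \<Sum>j\<in>K \<times> K. q i * R g i j * p j) = of_real (\<Sum>s\<in>I \<times> I. (cmod (\<Lambda> s g))\<^sup>2)" for g
    unfolding q_def R_def p_def by (rule mat_rep_gram[OF \<sigma> \<Lambda>_def])
  \<comment> \<open>The subtracted constant is the value at the identity, where all
    \<open>\<Lambda> s\<close> vanish, so the difference is the whole sum of squares.\<close>
  have "(\<Sum>i\<in>K \<times> K. q i * p i) = (\<Sum>i\<in>K \<times> K. \<Sum>j\<in>K \<times> K. q i * R \<one>\<^bsub>G\<^esub> i j * p j)"
  proof (rule sum.cong)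
    fix i assume i: "i \<in> K \<times> K"
    have *: "q i * R \<one>\<^bsub>G\<^esub> i j * p j = (if i = j then q i * p j else 0)" if "j \<in> K \<times> K" for j
      unfolding mat_repD(3)[OF R i that] by simp
    have "(\<Sum>j\<in>K \<times> K. q i * R \<one>\<^bsub>G\<^esub> i j * p j) = (\<Sum>j\<in>K \<times> K. if i = j then q i * p j else 0)"
      by (rule sum.cong[OF HOL.refl *])
    also have "\<dots> = q i * p i" using i by (simp add: mat_repD(1)[OF R])
    finally show "q i * p i = (\<Sum>j\<in>K \<times> K. q i * R \<one>\<^bsub>G\<^esub> i j * p j)" by simp
  qed simp
  also have "\<dots> = 0"
  proof -
    have "\<Lambda> s \<one>\<^bsub>G\<^esub> = 0" if "s \<in> I \<times> I" for s
      using that by (auto simp: \<Lambda> one) (auto simp: I_def)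
    then show ?thesis unfolding eq by simp
  qed
  finally have qp: "(\<Sum>i\<in>K \<times> K. q i * p i) = 0" .
  have "\<exists>r>0. (\<Sum>i\<in>K \<times> K. \<Sum>j\<in>K \<times> K. q i * R g i j * p j) - (\<Sum>i\<in>K \<times> K. q i * p i) = of_real r"
    if g: "g \<in> carrier G" "g \<noteq> \<one>\<^bsub>G\<^esub>" for g
  proof -
    have "\<theta> g \<noteq> 1\<^sub>m n" using inj_onD[OF inj, of g "\<one>\<^bsub>G\<^esub>"] g one by auto
    then obtain i j where ij: "i < n" "j < n" "\<theta> g $$ (i, j) \<noteq> 1\<^sub>m n $$ (i, j)"
      using cm[OF g(1)] by (metis carrier_matD eq_matI index_one_mat(2,3))
    then have "\<Lambda> (i, j) g \<noteq> 0" by (auto simp: \<Lambda> I_def)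
    then have "(\<Sum>s\<in>I \<times> I. (cmod (\<Lambda> s g))\<^sup>2) > 0"
      using ij by (intro sum_pos2[of _ "(i, j)"]) (auto simp: I_def)
    then show ?thesis unfolding eq qp by (intro exI[of _ "\<Sum>s\<in>I \<times> I. (cmod (\<Lambda> s g))\<^sup>2"]) simp
  qed
  then show ?thesis using R by blast
qed

section \<open>The action of reduced words\<close>

text \<open>Coefficients supported on \<open>I\<close> also say that the value depends only on the
  coordinates in \<open>I\<close>, so the action on functions can be recorded by a finite
  matrix.\<close>

definition linear_form :: "'i set \<Rightarrow> (('i \<Rightarrow> 'r::comm_ring_1) \<Rightarrow> 'r) \<Rightarrow> bool" where
  "linear_form I f \<longleftrightarrow> (\<exists>c. \<forall>y. f y = (\<Sum>k\<in>I. c k * y k))"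

definition delta :: "'i \<Rightarrow> 'i \<Rightarrow> 'r::comm_ring_1" where
  "delta k x = (if x = k then 1 else 0)"

lemma linear_formI: "(\<And>y. f y = (\<Sum>k\<in>I. c k * y k)) \<Longrightarrow> linear_form I f"
  by (auto simp: linear_form_def)

lemma linear_form_coord: "finite I \<Longrightarrow> k \<in> I \<Longrightarrow> linear_form I (\<lambda>y. y k)"
  by (rule linear_formI[where c = "delta k"]) (simp add: delta_def if_distrib[of "\<lambda>x. x * _"] cong: if_cong)

lemma linear_form_mult: "linear_form I f \<Longrightarrow> linear_form I (\<lambda>y. a * f y)"
  unfolding linear_form_def
  by (elim exE) (rule_tac x = "\<lambda>k. a * c k" in exI, simp add: sum_distrib_left mult.assoc)

lemma linear_form_add: "linear_form I f \<Longrightarrow> linear_form I g \<Longrightarrow> linear_form I (\<lambda>y. f y + g y)"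
  unfolding linear_form_def
  by (elim exE) (rule_tac x = "\<lambda>k. c k + ca k" in exI, simp add: sum.distrib distrib_right)

lemma linear_form_diff:
  assumes "linear_form I f" "linear_form I g"
  shows "linear_form I (\<lambda>y. f y - g y)"
  using linear_form_add[OF assms(1) linear_form_mult[OF assms(2), of "- 1"]] by simp

lemma linear_form_sum: "(\<And>i. i \<in> A \<Longrightarrow> linear_form I (f i)) \<Longrightarrow> linear_form I (\<lambda>y. \<Sum>i\<in>A. f i y)"
proof (induction A rule: infinite_finite_induct)
  case (insert x F)
  then show ?case by (simp add: linear_form_add)
qed (auto intro: linear_formI[where c = "\<lambda>_. 0"])

lemma linear_form_comp:
  assumes "linear_form I f" "\<And>k. k \<in> I \<Longrightarrow> linear_form I (\<lambda>y. T y k)"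
  shows "linear_form I (\<lambda>y. f (T y))"
proof -
  obtain c where "\<And>y. f y = (\<Sum>k\<in>I. c k * y k)" using assms(1) by (auto simp: linear_form_def)
  then show ?thesis using assms(2) by (auto intro!: linear_form_sum linear_form_mult)
qed

lemma linear_form_expand:
  assumes "finite I" "linear_form I f"
  shows "f y = (\<Sum>k\<in>I. f (delta k) * y k)"
proof -
  obtain c where c: "\<And>y. f y = (\<Sum>k\<in>I. c k * y k)" using assms(2) by (auto simp: linear_form_def)
  have "f (delta k) = c k" if "k \<in> I" for k
    using assms(1) that by (simp add: c delta_def if_distrib[of "\<lambda>x. _ * x"] cong: if_cong)
  then show ?thesis using c[of y] by simp
qed

lemma linear_form_smult: "linear_form I f \<Longrightarrow> linear_form I (\<lambda>y. smult a (f y :: 'r::comm_ring_1 poly))"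
  using linear_form_mult[of I f "[:a:]"] by simp

lemma linear_form_pCons: "linear_form I f \<Longrightarrow> linear_form I (\<lambda>y. pCons 0 (f y :: 'r::comm_ring_1 poly))"
  using linear_form_mult[of I f "[:0, 1:]"] by simp

lemma smult_sum_right: "smult a (sum f A) = (\<Sum>i\<in>A. smult a (f i))"
  by (induction A rule: infinite_finite_induct) (simp_all add: smult_add_right)

text \<open>The vertices of those letters of a word that can be moved to its front by commutations.\<close>

fun firsts :: "'v set set \<Rightarrow> ('v \<times> 'a) list \<Rightarrow> 'v set" where
  "firsts E [] = {}"
| "firsts E ((v, g) # w) = insert v {u \<in> firsts E w. {u, v} \<in> E}"

text \<open>A letter can be merged with a later one from its own vertex group when that one can be
  moved to the front of what follows. Testing every suffix excludes all such mergers.\<close>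

fun reduced :: "('v \<Rightarrow> ('a, 'b) monoid_scheme) \<Rightarrow> 'v set set \<Rightarrow> ('v \<times> 'a) list \<Rightarrow> bool" where
  "reduced G E [] \<longleftrightarrow> True"
| "reduced G E ((v, g) # w) \<longleftrightarrow> g \<noteq> \<one>\<^bsub>G v\<^esub> \<and> v \<notin> firsts E w \<and> reduced G E w"

locale positive_family = group_family V G
  for V :: "'v set" and G :: "'v \<Rightarrow> ('a, 'b) monoid_scheme" +
  fixes E :: "'v set set" and J :: "'v \<Rightarrow> 'j set" and R :: "'v \<Rightarrow> 'a \<Rightarrow> 'j \<Rightarrow> 'j \<Rightarrow> complex"
    and q p :: "'v \<Rightarrow> 'j \<Rightarrow> complex"
  assumes finite_V: "finite V"
    and graph: "simplicial_graph V E"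
    and rep: "v \<in> V \<Longrightarrow> mat_rep (G v) (J v) (R v)"
    and pos: "v \<in> V \<Longrightarrow> g \<in> carrier (G v) \<Longrightarrow> g \<noteq> \<one>\<^bsub>G v\<^esub> \<Longrightarrow>
      \<exists>r>0. (\<Sum>i\<in>J v. \<Sum>j\<in>J v. q v i * R v g i j * p v j) - (\<Sum>i\<in>J v. q v i * p v i) = of_real r"
begin

definition index :: "('v \<times> 'j) option set" where
  "index = insert None (Some ` (SIGMA v:V. J v))"

text \<open>Leaving out \<open>v\<close> keeps the inflow of \<open>v\<close> constant under letters
  of \<open>v\<close>; leaving out its neighbours hides commuting letters from one another.\<close>

definition free_of :: "'v \<Rightarrow> 'v set" where
  "free_of v = {u\<in>V. u \<noteq> v \<and> {u, v} \<notin> E}"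

definition read :: "'v \<Rightarrow> (('v \<times> 'j) option \<Rightarrow> complex poly) \<Rightarrow> complex poly" where
  "read v y = (\<Sum>i\<in>J v. smult (q v i) (y (Some (v, i))))"

definition inflow :: "'v \<Rightarrow> (('v \<times> 'j) option \<Rightarrow> complex poly) \<Rightarrow> complex poly" where
  "inflow v y = y None + (\<Sum>u\<in>free_of v. read u y)"

definition shear :: "'v \<Rightarrow> (('v \<times> 'j) option \<Rightarrow> complex poly) \<Rightarrow> 'j \<Rightarrow> complex poly" where
  "shear v y i = smult (p v i) (pCons 0 (inflow v y))"

text \<open>
  The representation \<open>R v\<close> on the block of \<open>v\<close>, conjugated by the shear that adds \<open>t p\<close> times the
  inflow, where \<open>t\<close> is the polynomial variable (multiplication by \<open>t\<close> is \<open>pCons 0\<close>).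
\<close>

definition letter_act :: "'v \<Rightarrow> 'a \<Rightarrow> (('v \<times> 'j) option \<Rightarrow> complex poly) \<Rightarrow> ('v \<times> 'j) option \<Rightarrow> complex poly" where
  "letter_act v g y = (\<lambda>x. case x of None \<Rightarrow> y None
     | Some (u, i) \<Rightarrow> if u = v \<and> i \<in> J v
         then (\<Sum>j\<in>J v. smult (R v g i j) (y (Some (v, j)) + shear v y j)) - shear v y i
         else y (Some (u, i)))"

lemma letter_act_None [simp]: "letter_act v g y None = y None"
  by (simp add: letter_act_def)

lemma letter_act_other [simp]: "u \<noteq> v \<Longrightarrow> letter_act v g y (Some (u, i)) = y (Some (u, i))"
  by (simp add: letter_act_def)

lemma letter_act_outside [simp]: "i \<notin> J u \<Longrightarrow> letter_act v g y (Some (u, i)) = y (Some (u, i))"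
  by (auto simp: letter_act_def)

lemma letter_act_at: "i \<in> J v \<Longrightarrow> letter_act v g y (Some (v, i)) =
    (\<Sum>j\<in>J v. smult (R v g i j) (y (Some (v, j)) + shear v y j)) - shear v y i"
  by (simp add: letter_act_def)

lemma read_letter_act: "u \<noteq> v \<Longrightarrow> read u (letter_act v g y) = read u y"
  by (simp add: read_def)

lemma inflow_letter_act_unaffected: "v \<notin> free_of u \<Longrightarrow> inflow u (letter_act v g y) = inflow u y"
  unfolding inflow_def by (intro arg_cong2[of _ _ _ _ "(+)"] sum.cong) (auto intro!: read_letter_act)

lemma inflow_letter_act: "inflow v (letter_act v g y) = inflow v y"
  by (rule inflow_letter_act_unaffected) (simp add: free_of_def)

text \<open>The shear is the same before and after a letter of \<open>v\<close>, so the inner shears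
  cancel and multiplicativity of \<open>R v\<close> remains.\<close>

lemma letter_act_mult:
  assumes v: "v \<in> V" "g \<in> carrier (G v)" "h \<in> carrier (G v)"
  shows "letter_act v (g \<otimes>\<^bsub>G v\<^esub> h) y = letter_act v g (letter_act v h y)"
proof
  fix x
  have "letter_act v (g \<otimes>\<^bsub>G v\<^esub> h) y (Some (v, i)) = letter_act v g (letter_act v h y) (Some (v, i))" if i: "i \<in> J v" for i
  proof -
    let ?s = "shear v y" and ?y = "\<lambda>j. y (Some (v, j)) + shear v y j"
    have s: "shear v (letter_act v h y) = ?s" by (simp add: shear_def[abs_def] inflow_letter_act)
    have "(\<Sum>j\<in>J v. smult (R v g i j) (letter_act v h y (Some (v, j)) + ?s j)) =
        (\<Sum>j\<in>J v. \<Sum>k\<in>J v. smult (R v g i j * R v h j k) (?y k))"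
      by (simp add: letter_act_at smult_sum_right)
    also have "\<dots> = (\<Sum>k\<in>J v. smult (R v (g \<otimes>\<^bsub>G v\<^esub> h) i k) (?y k))"
      using i v by (subst sum.swap) (simp add: mat_repD(2)[OF rep] smult_sum)
    finally show ?thesis using i by (simp add: letter_act_at s)
  qed
  then show "letter_act v (g \<otimes>\<^bsub>G v\<^esub> h) y x = letter_act v g (letter_act v h y) x"
    by (cases x) (auto simp: letter_act_def split: if_splits)
qed

lemma letter_act_one:
  assumes v: "v \<in> V"
  shows "letter_act v \<one>\<^bsub>G v\<^esub> y = y"
proof
  fix x
  have "letter_act v \<one>\<^bsub>G v\<^esub> y (Some (v, i)) = y (Some (v, i))" if i: "i \<in> J v" for i
  proof -
    have "(\<Sum>j\<in>J v. smult (R v \<one>\<^bsub>G v\<^esub> i j) (y (Some (v, j)) + shear v y j)) =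
        (\<Sum>j\<in>J v. if i = j then y (Some (v, j)) + shear v y j else 0)"
      using i by (intro sum.cong) (auto simp: mat_repD(3)[OF rep[OF v]])
    then show ?thesis using i mat_repD(1)[OF rep[OF v]] by (simp add: letter_act_at)
  qed
  then show "letter_act v \<one>\<^bsub>G v\<^esub> y x = y x" by (cases x) (auto simp: letter_act_def split: if_splits)
qed

lemma letter_act_commute:
  assumes "{v, u} \<in> E"
  shows "letter_act v g (letter_act u h y) = letter_act u h (letter_act v g y)"
proof
  fix x
  have uv: "u \<noteq> v" using assms graph by (force simp: simplicial_graph_def)
  have "u \<notin> free_of v" "v \<notin> free_of u"
    using assms by (auto simp: free_of_def insert_commute)
  then have s: "shear v (letter_act u h y) = shear v y" "shear u (letter_act v g y) = shear u y"
    by (simp_all add: shear_def[abs_def] inflow_letter_act_unaffected)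
  show "letter_act v g (letter_act u h y) x = letter_act u h (letter_act v g y) x"
  proof (cases x)
    case (Some z)
    obtain a i where "z = (a, i)" by (cases z)
    then show ?thesis using Some s uv
      by (cases "i \<in> J a"; cases "a = v"; cases "a = u") (simp_all add: letter_act_at)
  qed simp
qed

section \<open>Words acting by linear maps\<close>

definition act :: "('v \<times> 'a) list \<Rightarrow> (('v \<times> 'j) option \<Rightarrow> complex poly) \<Rightarrow> ('v \<times> 'j) option \<Rightarrow> complex poly" where
  "act w = foldr (\<lambda>(v, g). letter_act v g) w"

lemma act_simps [simp]: "act [] y = y" "act ((v, g) # w) y = letter_act v g (act w y)"
  by (simp_all add: act_def)

lemma act_append: "act (w @ w') y = act w (act w' y)"
  by (simp add: act_def)

lemma act_fp_rel: "(w, w') \<in> fp_rel V G \<Longrightarrow> act w y = act w' y"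
  by (induction rule: fp_rel.induct) (simp_all add: act_append letter_act_mult letter_act_one)

lemma finite_index: "finite index"
  using finite_V mat_repD(1)[OF rep] by (auto simp: index_def)

lemma linear_form_letter_act:
  assumes v: "v \<in> V" and x: "x \<in> index"
  shows "linear_form index (\<lambda>y. letter_act v g y x)"
proof -
  have c: "linear_form index (\<lambda>y. y (Some (u, i)))" if "u \<in> V" "i \<in> J u" for u i
    using that by (intro linear_form_coord finite_index) (auto simp: index_def)
  have n: "linear_form index (\<lambda>y. y None)"
    by (intro linear_form_coord finite_index) (auto simp: index_def)
  have s: "linear_form index (\<lambda>y. shear v y i)" for i
    unfolding shear_def inflow_def read_def
    by (intro linear_form_smult linear_form_pCons linear_form_add linear_form_sum c n)
       (auto simp: free_of_def)
  show ?thesis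
  proof (cases x)
    case None
    then show ?thesis using n by simp
  next
    case (Some z)
    then obtain u i where z: "x = Some (u, i)" "u \<in> V" "i \<in> J u" using x by (auto simp: index_def)
    show ?thesis
    proof (cases "u = v")
      case True
      show ?thesis unfolding z True
        using z True v by (simp add: letter_act_at) (intro linear_form_diff linear_form_sum linear_form_smult linear_form_add c s; simp)
    next
      case False
      then show ?thesis using z c by simp
    qed
  qed
qed

lemma linear_form_act:
  assumes "w \<in> fp_words V G" "x \<in> index"
  shows "linear_form index (\<lambda>y. act w y x)"
  using assms
proof (induction w arbitrary: x)
  case Nil
  then show ?case by (simp add: linear_form_coord finite_index)
next
  case (Cons a w)
  obtain v g where "a = (v, g)" by (cases a)
  then show ?case using Cons by (auto intro: linear_form_comp linear_form_letter_act)
qed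

text \<open>
  Along a reduced word the degrees \<open>d v\<close> of the blocks behave as in a ping-pong argument: a vertex
  that can be moved to the front dominates every vertex it does not commute with, and
  positivity of the leading coefficients excludes cancellation.
\<close>

definition dominated :: "('v \<times> 'a) list \<Rightarrow> (('v \<times> 'j) option \<Rightarrow> complex poly) \<Rightarrow> ('v \<Rightarrow> nat) \<Rightarrow> bool" where
  "dominated w y d \<longleftrightarrow> y None = 1 \<and>
     (\<forall>v\<in>V. (\<forall>i\<in>J v. degree (y (Some (v, i))) \<le> d v) \<and>
       0 \<le> Re (coeff (read v y) (d v)) \<and> (0 < d v \<longrightarrow> 0 < Re (coeff (read v y) (d v)))) \<and>
     (\<forall>v\<in>V - firsts E w. d v = 0 \<or> (\<exists>u\<in>free_of v. d v \<le> d u)) \<and>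
     (\<forall>v\<in>firsts E w. 0 < d v \<and> (\<forall>u\<in>free_of v. d u < d v))"

lemma free_of_sym: "v \<in> V \<Longrightarrow> u \<in> free_of v \<Longrightarrow> v \<in> free_of u"
  by (auto simp: free_of_def insert_commute)

lemma degree_read: "(\<And>i. i \<in> J v \<Longrightarrow> degree (y (Some (v, i))) \<le> n) \<Longrightarrow> degree (read v y) \<le> n"
  unfolding read_def
  by (cases "finite (J v)") (auto intro!: degree_sum_le order.trans[OF degree_smult_le])

text \<open>The old entries in the block of \<open>v\<close> have degree at most \<open>D\<close>,
  the top degree of the inflow. So the coefficient of degree \<open>Suc D\<close> in the new reading
  comes from the inflow alone: it is the coefficient of the inflow in degree \<open>D\<close> times
  the positive number \<open>r\<close>.\<close>

lemma dominated_step: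
  assumes dom: "dominated w y d" and v: "v \<in> V" "v \<notin> firsts E w"
    and g: "g \<in> carrier (G v)" "g \<noteq> \<one>\<^bsub>G v\<^esub>"
  shows "\<exists>d'. dominated ((v, g) # w) (letter_act v g y) d'"
proof -
  have y1: "y None = 1"
    and dy: "\<And>u i. u \<in> V \<Longrightarrow> i \<in> J u \<Longrightarrow> degree (y (Some (u, i))) \<le> d u"
    and nn: "\<And>u. u \<in> V \<Longrightarrow> 0 \<le> Re (coeff (read u y) (d u))"
    and pp: "\<And>u. u \<in> V \<Longrightarrow> 0 < d u \<Longrightarrow> 0 < Re (coeff (read u y) (d u))"
    and nf: "\<And>u. u \<in> V \<Longrightarrow> u \<notin> firsts E w \<Longrightarrow> d u = 0 \<or> (\<exists>x\<in>free_of u. d u \<le> d x)"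
    and ff: "\<And>u. u \<in> firsts E w \<Longrightarrow> 0 < d u" "\<And>u x. u \<in> firsts E w \<Longrightarrow> x \<in> free_of u \<Longrightarrow> d x < d u"
    using dom by (auto simp: dominated_def)
  have fin: "finite (free_of v)" using finite_V by (simp add: free_of_def)
  \<comment> \<open>The inserted 0 is the degree of the base coordinate; it also keeps
    \<open>D\<close> defined when \<open>free_of v\<close> is empty.\<close>
  define D where "D = Max (insert 0 (d ` free_of v))"
  have dD: "d u \<le> D" if "u \<in> free_of v" for u using that fin by (auto simp: D_def)
  have DD: "D = 0 \<or> (\<exists>u\<in>free_of v. d u = D)"
    using Max_in[of "insert 0 (d ` free_of v)"] fin unfolding D_def by auto
  \<comment> \<open>Reducedness enters here: as \<open>v\<close> cannot be moved to the front of
    \<open>w\<close>, its degree bound is 0 or at most that of some block in its inflow.\<close>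
  have dvD: "d v \<le> D" using nf[OF v] dD by fastforce
  define S where "S = inflow v y"
  have dr: "degree (read u y) \<le> d u" if "u \<in> V" for u using degree_read dy that by blast
  have subV: "free_of v \<subseteq> V" by (auto simp: free_of_def)
  have low: "coeff (read u y) D = 0" if "u \<in> free_of v" "d u \<noteq> D" for u
    using dr[of u] dD[OF that(1)] subV that by (intro coeff_eq_0) auto
  have SD: "degree S \<le> D"
    unfolding S_def inflow_def y1 using dr dD subV fin
    by (intro degree_add_le degree_sum_le) (auto intro: order.trans)
  \<comment> \<open>All contributions have nonnegative real part. A positive one is the base
    coordinate if \<open>D = 0\<close>, and a block attaining \<open>D\<close> otherwise.\<close>
  have "Re (coeff S D) = (if D = 0 then 1 else 0) + (\<Sum>u\<in>free_of v. Re (coeff (read u y) D))"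
    by (simp add: S_def inflow_def y1 coeff_sum coeff_1)
  moreover have ge: "0 \<le> Re (coeff (read u y) D)" if "u \<in> free_of v" for u
    using low[OF that] nn[of u] subV that by (cases "d u = D") auto
  moreover have "0 < (\<Sum>u\<in>free_of v. Re (coeff (read u y) D))" if D0: "D \<noteq> 0"
  proof -
    obtain u where u: "u \<in> free_of v" "d u = D" using DD D0 by auto
    then have "0 < Re (coeff (read u y) D)" using pp[of u] subV D0 by auto
    then show ?thesis using u fin ge by (intro sum_pos2[of _ u]) auto
  qed
  ultimately have SR: "0 < Re (coeff S D)"
    using sum_nonneg[of "free_of v" "\<lambda>u. Re (coeff (read u y) D)"] by (cases "D = 0") auto
  have sh: "degree (shear v y i) \<le> Suc D" for i
    unfolding shear_def S_def[symmetric]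
    using SD by (intro order.trans[OF degree_smult_le] order.trans[OF degree_pCons_le]) simp
  have shc: "coeff (shear v y i) (Suc D) = p v i * coeff S D" for i
    by (simp add: shear_def S_def)
  have finJ: "finite (J v)" using mat_repD(1)[OF rep[OF v(1)]] .
  have dT: "degree (letter_act v g y (Some (v, i))) \<le> Suc D" if "i \<in> J v" for i
    using that sh dvD dy[OF v(1)] finJ unfolding letter_act_at[OF that]
    by (intro degree_diff_le degree_sum_le order.trans[OF degree_smult_le] degree_add_le)
       (auto intro: le_SucI order.trans)
  obtain r where r: "r > 0"
    "(\<Sum>i\<in>J v. \<Sum>j\<in>J v. q v i * R v g i j * p v j) - (\<Sum>i\<in>J v. q v i * p v i) = of_real r"
    using pos[OF v(1) g] by blast
  have "coeff (read v (letter_act v g y)) (Suc D) = of_real r * coeff S D"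
  proof -
    have "coeff (letter_act v g y (Some (v, i))) (Suc D) =
        (\<Sum>j\<in>J v. R v g i j * (p v j * coeff S D)) - p v i * coeff S D" if "i \<in> J v" for i
    proof -
      have "coeff (y (Some (v, j))) (Suc D) = 0" if "j \<in> J v" for j
        using dy[OF v(1) that] dvD by (intro coeff_eq_0) simp
      then show ?thesis using that by (simp add: letter_act_at coeff_sum shc)
    qed
    then have "coeff (read v (letter_act v g y)) (Suc D) =
        (\<Sum>i\<in>J v. q v i * ((\<Sum>j\<in>J v. R v g i j * (p v j * coeff S D)) - p v i * coeff S D))"
      by (simp add: read_def coeff_sum)
    also have "\<dots> = ((\<Sum>i\<in>J v. \<Sum>j\<in>J v. q v i * R v g i j * p v j) - (\<Sum>i\<in>J v. q v i * p v i)) * coeff S D"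
      by (simp add: left_diff_distrib right_diff_distrib sum_subtractf sum_distrib_left sum_distrib_right mult.assoc)
    finally show ?thesis by (simp add: r)
  qed
  then have rT: "0 < Re (coeff (read v (letter_act v g y)) (Suc D))" using r SR by simp
  define d' where "d' = d(v := Suc D)"
  have "dominated ((v, g) # w) (letter_act v g y) d'"
    unfolding dominated_def
  proof (intro conjI ballI)
    show "letter_act v g y None = 1" by (simp add: y1)
  next
    fix u i assume "u \<in> V" "i \<in> J u"
    then show "degree (letter_act v g y (Some (u, i))) \<le> d' u" using dT dy by (cases "u = v") (auto simp: d'_def)
  next
    fix u assume "u \<in> V"
    then show "0 \<le> Re (coeff (read u (letter_act v g y)) (d' u))"
      using rT nn by (cases "u = v") (auto simp: d'_def read_letter_act)
    show "0 < d' u \<longrightarrow> 0 < Re (coeff (read u (letter_act v g y)) (d' u))"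
      using rT pp[OF \<open>u \<in> V\<close>] by (cases "u = v") (auto simp: d'_def read_letter_act)
  next
    fix u assume u: "u \<in> V - firsts E ((v, g) # w)"
    then have uv: "u \<noteq> v" "u \<in> V" by auto
    show "d' u = 0 \<or> (\<exists>x\<in>free_of u. d' u \<le> d' x)"
    proof (cases "u \<in> firsts E w")
      case True
      \<comment> \<open>A vertex that loses its place in front is not joined to \<open>v\<close>, so
        the raised degree of \<open>v\<close> now dominates it.\<close>
      then have "u \<in> free_of v" using u uv by (auto simp: free_of_def)
      then have "v \<in> free_of u" "d' u \<le> d' v" using free_of_sym v dD uv by (auto simp: d'_def le_SucI)
      then show ?thesis by blast
    next
      case False
      from nf[OF uv(2) this] show ?thesis
      proof
        assume "\<exists>x\<in>free_of u. d u \<le> d x"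
        then obtain x where "x \<in> free_of u" "d u \<le> d x" by blast
        moreover from this have "d' u \<le> d' x" using uv dvD by (auto simp: d'_def)
        ultimately show ?thesis by blast
      qed (use uv in \<open>simp add: d'_def\<close>)
    qed
  next
    fix u assume u: "u \<in> firsts E ((v, g) # w)"
    show "0 < d' u" using u ff(1) by (auto simp: d'_def)
    fix x assume x: "x \<in> free_of u"
    show "d' x < d' u"
    proof (cases "u = v")
      case True
      then show ?thesis using x dD by (auto simp: d'_def free_of_def less_Suc_eq_le)
    next
      case False
      then have "u \<in> firsts E w" "{u, v} \<in> E" using u by auto
      \<comment> \<open>A vertex other than \<open>v\<close> that is still movable to the front is
        joined to \<open>v\<close>, so the raised degree does not enter its comparisons.\<close>
      then have "x \<noteq> v" using x by (auto simp: free_of_def insert_commute)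
      then show ?thesis using ff(2) \<open>u \<in> firsts E w\<close> x False by (auto simp: d'_def)
    qed
  qed
  then show ?thesis by blast
qed

lemma reduced_dominated:
  assumes "w \<in> fp_words V G" "reduced G E w"
  shows "\<exists>d. dominated w (act w (delta None)) d"
  using assms
proof (induction w)
  case Nil
  show ?case by (rule exI[of _ "\<lambda>_. 0"]) (simp add: dominated_def delta_def read_def)
next
  case (Cons a w)
  obtain v g where a: "a = (v, g)" by (cases a)
  then obtain d where "dominated w (act w (delta None)) d" using Cons by auto
  then show ?case using dominated_step[of w _ d v g] Cons.prems a by auto
qed

text \<open>The block of the first letter has a positive degree bound, attained by a nonzero
  coefficient of its reading, whereas the base vector is zero on every block.\<close>

lemma reduced_acts_nontrivially:
  assumes "w \<in> fp_words V G" "reduced G E w" "w \<noteq> []"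
  shows "\<exists>x\<in>index. act w (delta None) x \<noteq> delta None x"
proof (rule ccontr)
  assume triv: "\<not> ?thesis"
  obtain d where d: "dominated w (act w (delta None)) d" using reduced_dominated assms by blast
  obtain v g w' where w: "w = (v, g) # w'" using assms(3) by (cases w) auto
  then have v: "v \<in> V" "v \<in> firsts E w" using assms(1) by auto
  then have "0 < d v" using d by (auto simp: dominated_def)
  then have "0 < Re (coeff (read v (act w (delta None))) (d v))" using d v by (auto simp: dominated_def)
  moreover have "act w (delta None) (Some (v, i)) = 0" if "i \<in> J v" for i
    using triv v that by (auto simp: index_def delta_def)
  ultimately show False by (simp add: read_def)
qed

end

section \<open>The graph product as a group of matrices\<close>

context positive_family
begin

abbreviation "FP \<equiv> free_product V G"
abbreviation "relator_closure \<equiv> normal_closure FP (graph_product_relators V E G)"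
abbreviation "word_class w \<equiv> fp_rel V G `` {w}"

definition word_coset :: "('v \<times> 'a) list \<Rightarrow> ('v \<times> 'a) list set set" where
  "word_coset w = relator_closure #>\<^bsub>FP\<^esub> word_class w"

lemma word_class_carrier: "w \<in> fp_words V G \<Longrightarrow> word_class w \<in> carrier FP"
  by (simp add: free_product_def quotientI)

lemma carrier_FP: "A \<in> carrier FP \<Longrightarrow> \<exists>w\<in>fp_words V G. A = word_class w"
  by (auto simp: free_product_def elim: quotientE)

lemma one_FP: "\<one>\<^bsub>FP\<^esub> = word_class []"
  by (simp add: free_product_def)

lemma edge_vertices: "{v, u} \<in> E \<Longrightarrow> v \<in> V \<and> u \<in> V"
  using graph by (auto simp: simplicial_graph_def)

lemma relators_carrier: "graph_product_relators V E G \<subseteq> carrier FP"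
proof -
  interpret F: group FP by (rule group_free_product)
  show ?thesis
    by (auto simp: graph_product_relators_def group_commutator_def fp_incl_def word_class_carrier
        dest: edge_vertices intro!: F.m_closed F.inv_closed)
qed

lemma normal_relator_closure: "relator_closure \<lhd> FP"
  by (rule group.normal_normal_closure[OF group_free_product relators_carrier])

lemma word_coset_append:
  assumes "x \<in> fp_words V G" "y \<in> fp_words V G"
  shows "word_coset (x @ y) = word_coset x <#>\<^bsub>FP\<^esub> word_coset y"
  using assms normal.rcos_sum[OF normal_relator_closure word_class_carrier word_class_carrier]
  by (simp add: word_coset_def fp_mult)

lemma word_coset_cong:
  assumes "word_coset w = word_coset w'" "w \<in> fp_words V G" "w' \<in> fp_words V G" "x \<in> fp_words V G" "y \<in> fp_words V G"
  shows "word_coset (x @ w @ y) = word_coset (x @ w' @ y)"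
  using assms by (simp add: word_coset_append)

lemma word_coset_fp_rel: "(w, w') \<in> fp_rel V G \<Longrightarrow> word_coset w = word_coset w'"
  by (simp add: word_coset_def equiv_class_eq[OF equiv_fp_rel])

lemma word_coset_commute:
  assumes E: "{v, u} \<in> E" and g: "g \<in> carrier (G v)" and h: "h \<in> carrier (G u)"
  shows "word_coset [(v, g), (u, h)] = word_coset [(u, h), (v, g)]"
proof -
  interpret F: group FP by (rule group_free_product)
  interpret N: normal relator_closure FP by (rule normal_relator_closure)
  let ?a = "word_class [(v, g)]" and ?b = "word_class [(u, h)]"
  let ?c = "group_commutator FP ?a ?b"
  have V: "v \<in> V" "u \<in> V" using edge_vertices E by auto
  have ab: "?a \<in> carrier FP" "?b \<in> carrier FP" using V g h by (auto intro: word_class_carrier)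
  have "?c \<in> graph_product_relators V E G"
    using E g h unfolding graph_product_relators_def fp_incl_def by blast
  then have c: "?c \<in> relator_closure" by (auto simp: normal_closure_def)
  have cc: "?c \<in> carrier FP" using ab by (simp add: group_commutator_def)
  have "?a \<otimes>\<^bsub>FP\<^esub> ?b = ?c \<otimes>\<^bsub>FP\<^esub> (?b \<otimes>\<^bsub>FP\<^esub> ?a)"
    using ab by (simp add: group_commutator_def F.m_assoc F.inv_solve_left flip: F.m_assoc[of _ "?b" "?a"])
  then have "relator_closure #>\<^bsub>FP\<^esub> (?a \<otimes>\<^bsub>FP\<^esub> ?b) = relator_closure #>\<^bsub>FP\<^esub> ?c #>\<^bsub>FP\<^esub> (?b \<otimes>\<^bsub>FP\<^esub> ?a)"
    using cc ab N.subset by (simp add: F.coset_mult_assoc)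
  also have "relator_closure #>\<^bsub>FP\<^esub> ?c = relator_closure"
    by (rule F.coset_join2[OF cc N.subgroup_axioms c])
  finally show ?thesis using V g h by (simp add: word_coset_def fp_mult)
qed

section \<open>Reduced representatives in the graph product\<close>

text \<open>Each letter in front of the chosen one belongs to a joined vertex and is passed by a
  commutation. The length is recorded because a later merger has to shorten the word.\<close>

lemma firsts_front:
  assumes "w \<in> fp_words V G" "u \<in> firsts E w"
  shows "\<exists>h\<in>carrier (G u). \<exists>w'\<in>fp_words V G. length w = Suc (length w') \<and> word_coset w = word_coset ((u, h) # w')"
  using assms
proof (induction w)
  case (Cons a w)
  obtain v g where a: "a = (v, g)" by (cases a)
  have v: "v \<in> V" "g \<in> carrier (G v)" "w \<in> fp_words V G" using Cons.prems a by auto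
  show ?case
  proof (cases "u = v")
    case True
    then show ?thesis using a v by auto
  next
    case False
    then have u: "u \<in> firsts E w" "{u, v} \<in> E" using Cons.prems a by auto
    then obtain h w' where w': "h \<in> carrier (G u)" "w' \<in> fp_words V G" "length w = Suc (length w')"
      "word_coset w = word_coset ((u, h) # w')" using Cons.IH v by blast
    have "u \<in> V" using edge_vertices u by auto
    have "word_coset (a # w) = word_coset ([(v, g)] @ ((u, h) # w') @ [])"
      using word_coset_cong[OF w'(4), of "[(v, g)]" "[]"] a v w' \<open>u \<in> V\<close> by simp
    also have "\<dots> = word_coset ([] @ [(u, h), (v, g)] @ w')"
      using word_coset_cong[OF word_coset_commute[of v u g h], of "[]" w'] u v w' \<open>u \<in> V\<close>
      by (simp add: insert_commute)
    finally have "word_coset (a # w) = word_coset ((u, h) # (v, g) # w')" by simp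
    then show ?thesis using w' v by (intro bexI[of _ h] bexI[of _ "(v, g) # w'"]) auto
  qed
qed simp

text \<open>Reduce the tail and put the first letter back. If it merges with a letter movable to the
  front of the tail, the word becomes strictly shorter, by the length bound in the conclusion, and
  the induction hypothesis applies again.\<close>

lemma ex_reduced:
  assumes "w \<in> fp_words V G"
  shows "\<exists>w'\<in>fp_words V G. reduced G E w' \<and> length w' \<le> length w \<and> word_coset w' = word_coset w"
  using assms
proof (induction "length w" arbitrary: w rule: less_induct)
  case less
  show ?case
  proof (cases w)
    case Nil
    then show ?thesis by (intro bexI[of _ "[]"]) auto
  next
    case (Cons a x)
    obtain v g where a: "a = (v, g)" by (cases a)
    have v: "v \<in> V" "g \<in> carrier (G v)" "x \<in> fp_words V G" using less.prems a Cons by auto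
    interpret Gv: group "G v" using v by (intro grp)
    obtain y where y: "y \<in> fp_words V G" "reduced G E y" "length y \<le> length x" "word_coset y = word_coset x"
      using less.hyps[of x] v Cons by auto
    have w: "word_coset w = word_coset ((v, g) # y)"
      using word_coset_cong[OF y(4), of "[(v, g)]" "[]"] y v Cons a by simp
    show ?thesis
    proof (cases "g = \<one>\<^bsub>G v\<^esub>")
      case True
      then have "word_coset w = word_coset y"
        using word_coset_fp_rel[OF fp_rel.one[of "[]" V G y v]] w y v by simp
      then show ?thesis using y Cons by (intro bexI[of _ y]) auto
    next
      case g1: False
      show ?thesis
      proof (cases "v \<in> firsts E y")
        case True
        obtain h z where z: "h \<in> carrier (G v)" "z \<in> fp_words V G" "length y = Suc (length z)"
          "word_coset y = word_coset ((v, h) # z)" using firsts_front[OF y(1) True] by blast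
        have "word_coset w = word_coset ([(v, g)] @ ((v, h) # z) @ [])"
          using word_coset_cong[OF z(4), of "[(v, g)]" "[]"] w y z v by simp
        also have "\<dots> = word_coset ((v, g \<otimes>\<^bsub>G v\<^esub> h) # z)"
          using word_coset_fp_rel[OF fp_rel.mult[of "[]" V G z v g h]] z v by simp
        finally have "word_coset w = word_coset ((v, g \<otimes>\<^bsub>G v\<^esub> h) # z)" .
        moreover have "(v, g \<otimes>\<^bsub>G v\<^esub> h) # z \<in> fp_words V G" using z v by simp
        moreover have "length ((v, g \<otimes>\<^bsub>G v\<^esub> h) # z) < length w" using z y Cons by simp
        ultimately obtain w' where "w' \<in> fp_words V G" "reduced G E w'" "word_coset w' = word_coset w"
          "length w' \<le> length ((v, g \<otimes>\<^bsub>G v\<^esub> h) # z)"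
          using less.hyps by metis
        then show ?thesis using \<open>length ((v, g \<otimes>\<^bsub>G v\<^esub> h) # z) < length w\<close>
          by (intro bexI[of _ w']) auto
      next
        case False
        then show ?thesis using w y v g1 Cons by (intro bexI[of _ "(v, g) # y"]) auto
      qed
    qed
  qed
qed

section \<open>The matrix representation and its kernel\<close>

lemma linear_graph_product: "linear_over_complex (graph_product V E G)"
proof -
  interpret F: group FP by (rule group_free_product)
  interpret N: normal relator_closure FP by (rule normal_relator_closure)
  obtain \<psi> :: "complex poly \<Rightarrow> complex" where "inj_comm_ring_hom \<psi>"
    using ex_poly_ring_embedding by blast
  then interpret \<psi>: inj_comm_ring_hom \<psi> .
  define n where "n = card index"
  obtain e where e: "bij_betw e {..<n} index"
    using ex_bij_betw_nat_finite[OF finite_index] by (auto simp: n_def atLeast0LessThan)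
  have e_in: "e i \<in> index" if "i < n" for i using e that by (auto simp: bij_betw_def)
  interpret L: group "GL n" by (rule group_GL)
  \<comment> \<open>Column \<open>j\<close> is the image of the basis vector at \<open>e j\<close>;
    \<open>\<psi>\<close> turns its polynomial coordinates into complex numbers.\<close>
  define \<Theta> where "\<Theta> w = mat n n (\<lambda>(i, j). \<psi> (act w (delta (e j)) (e i)))" for w
  have \<Theta>_cm: "\<Theta> w \<in> carrier_mat n n" for w by (simp add: \<Theta>_def)
  have \<Theta>_rel: "\<Theta> w = \<Theta> w'" if "(w, w') \<in> fp_rel V G" for w w'
    by (simp add: \<Theta>_def act_fp_rel[OF that])
  have \<Theta>_append: "\<Theta> (w @ w') = \<Theta> w * \<Theta> w'" if w: "w \<in> fp_words V G" for w w'
  proof (rule eq_matI)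
    fix i j assume "i < dim_row (\<Theta> w * \<Theta> w')" "j < dim_col (\<Theta> w * \<Theta> w')"
    then have ij: "i < n" "j < n" by (simp_all add: \<Theta>_def)
    have "act (w @ w') (delta (e j)) (e i) =
        (\<Sum>k\<in>index. act w (delta k) (e i) * act w' (delta (e j)) k)"
      unfolding act_append by (rule linear_form_expand[OF finite_index linear_form_act[OF w e_in[OF ij(1)]]])
    also have "\<dots> = (\<Sum>k<n. act w (delta (e k)) (e i) * act w' (delta (e j)) (e k))"
      by (rule sum.reindex_bij_betw[OF e, symmetric])
    finally show "\<Theta> (w @ w') $$ (i, j) = (\<Theta> w * \<Theta> w') $$ (i, j)"
      using ij by (simp add: \<Theta>_def scalar_prod_def atLeast0LessThan \<psi>.hom_sum \<psi>.hom_mult)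
  qed (simp_all add: \<Theta>_def)
  have inj_e: "e i = e j \<longleftrightarrow> i = j" if "i < n" "j < n" for i j
    using e that by (auto simp: bij_betw_def inj_on_def)
  have \<Theta>_Nil: "\<Theta> [] = 1\<^sub>m n"
    by (rule eq_matI) (auto simp: \<Theta>_def delta_def inj_e)
  have \<Theta>_GL: "\<Theta> w \<in> carrier (GL n)" if w: "w \<in> fp_words V G" for w
  proof -
    obtain y where y: "y \<in> fp_words V G" "(y @ w, []) \<in> fp_rel V G" using fp_inverse_word[OF w] by blast
    have "word_class y \<otimes>\<^bsub>FP\<^esub> word_class w = \<one>\<^bsub>FP\<^esub>"
      using w y equiv_class_eq[OF equiv_fp_rel y(2)] by (simp add: fp_mult one_FP)
    then have "word_class w \<otimes>\<^bsub>FP\<^esub> word_class y = \<one>\<^bsub>FP\<^esub>"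
      using F.inv_comm word_class_carrier w y by blast
    then have "word_class (w @ y) = word_class []" using w y by (simp add: fp_mult one_FP)
    then have "(w @ y, []) \<in> fp_rel V G" by (rule eq_equiv_class[OF _ equiv_fp_rel]) simp
    then have "\<Theta> w * \<Theta> y = 1\<^sub>m n" "\<Theta> y * \<Theta> w = 1\<^sub>m n"
      using \<Theta>_append w y \<Theta>_rel \<Theta>_Nil by metis+
    then show ?thesis using \<Theta>_cm[of w] \<Theta>_cm[of y]
      by (auto simp: carrier_GL invertible_mat_def inverts_mat_def)
  qed
  define \<Phi> where "\<Phi> A = the_elem (\<Theta> ` A)" for A
  have \<Phi>: "\<Phi> (word_class w) = \<Theta> w" if "w \<in> fp_words V G" for w
  proof -
    have "w \<in> word_class w" using fp_rel.refl[OF that] by simp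
    moreover have "\<Theta> x = \<Theta> w" if "x \<in> word_class w" for x
      using \<Theta>_rel[of w x] that by simp
    ultimately have "\<Theta> ` word_class w = {\<Theta> w}" by blast
    then show ?thesis by (simp add: \<Phi>_def)
  qed
  have mult_GL: "A \<otimes>\<^bsub>GL n\<^esub> B = A * B" and one_GL: "\<one>\<^bsub>GL n\<^esub> = 1\<^sub>m n" for A B
    by (simp_all add: GL_def units_of_def ring_mat_simps)
  have hom: "\<Phi> \<in> hom FP (GL n)"
  proof (rule homI)
    fix A B assume "A \<in> carrier FP" "B \<in> carrier FP"
    then obtain x y where "x \<in> fp_words V G" "A = word_class x" "y \<in> fp_words V G" "B = word_class y"
      using carrier_FP by blast
    then show "\<Phi> A \<in> carrier (GL n)" "\<Phi> (A \<otimes>\<^bsub>FP\<^esub> B) = \<Phi> A \<otimes>\<^bsub>GL n\<^esub> \<Phi> B"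
      by (simp_all add: \<Phi> \<Theta>_GL fp_mult \<Theta>_append mult_GL)
  qed
  interpret \<Phi>: group_hom FP "GL n" \<Phi>
    by unfold_locales (rule hom)
  have "\<Phi> (group_commutator FP (fp_incl V G v g) (fp_incl V G u h)) = \<one>\<^bsub>GL n\<^esub>"
    if *: "{v, u} \<in> E" "g \<in> carrier (G v)" "h \<in> carrier (G u)" for v g u h
  proof -
    have V: "v \<in> V" "u \<in> V" using edge_vertices * by auto
    let ?a = "word_class [(v, g)]" and ?b = "word_class [(u, h)]"
    have ab: "?a \<in> carrier FP" "?b \<in> carrier FP" using V * by (auto intro: word_class_carrier)
    have "\<Theta> [(v, g), (u, h)] = \<Theta> [(u, h), (v, g)]"
      by (simp add: \<Theta>_def letter_act_commute[OF *(1)])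
    then have "\<Phi> ?a \<otimes>\<^bsub>GL n\<^esub> \<Phi> ?b = \<Phi> ?b \<otimes>\<^bsub>GL n\<^esub> \<Phi> ?a"
      using V * \<Theta>_append[of "[(v, g)]" "[(u, h)]"] \<Theta>_append[of "[(u, h)]" "[(v, g)]"]
      by (simp add: \<Phi> mult_GL)
    then show ?thesis
      using ab by (simp add: group_commutator_def fp_incl_def L.m_assoc)
  qed
  then have "graph_product_relators V E G \<subseteq> kernel FP (GL n) \<Phi>"
    using relators_carrier unfolding kernel_def graph_product_relators_def by blast
  then have sub: "relator_closure \<subseteq> kernel FP (GL n) \<Phi>"
    unfolding normal_closure_def using \<Phi>.normal_kernel by blast
  \<comment> \<open>Faithfulness. A reduced representative \<open>w'\<close> differs from
    \<open>w\<close> by an element of the closure, so its matrix is the identity as well. As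
    \<open>\<psi>\<close> is injective, \<open>w'\<close> fixes the base vector and must be empty,
    which puts the class of \<open>w\<close> in the closure.\<close>
  have "kernel FP (GL n) \<Phi> \<subseteq> relator_closure"
  proof
    fix A assume "A \<in> kernel FP (GL n) \<Phi>"
    then obtain w where w: "w \<in> fp_words V G" "A = word_class w" "\<Theta> w = 1\<^sub>m n"
      using carrier_FP \<Phi> one_GL by (force simp: kernel_def)
    obtain w' where w': "w' \<in> fp_words V G" "reduced G E w'" "word_coset w' = word_coset w"
      using ex_reduced[OF w(1)] by blast
    have "word_class w' \<in> relator_closure #>\<^bsub>FP\<^esub> word_class w"
      using F.repr_independenceD[OF N.subgroup_axioms word_class_carrier[OF w'(1)]] w'(3)
      by (simp add: word_coset_def)
    then obtain m where "m \<in> relator_closure" "word_class w' = m \<otimes>\<^bsub>FP\<^esub> word_class w"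
      by (auto simp: r_coset_def)
    then have "\<Phi> (word_class w') = \<Phi> (word_class w)"
      using sub w word_class_carrier[OF w(1)] by (auto simp: kernel_def)
    then have \<Theta>w': "\<Theta> w' = 1\<^sub>m n" using w w' by (simp add: \<Phi>)
    have "act w' (delta None) x = delta None x" if x: "x \<in> index" for x
    proof -
      have "None \<in> index" by (simp add: index_def)
      then have "None \<in> e ` {..<n}" "x \<in> e ` {..<n}" using x e by (simp_all add: bij_betw_def)
      then obtain i j where ij: "i < n" "j < n" "x = e i" "None = e j" by blast
      have "\<psi> (act w' (delta (e j)) (e i)) = 1\<^sub>m n $$ (i, j)"
        using \<Theta>w' ij by (metis (no_types, lifting) \<Theta>_def index_mat(1) split_conv)
      also have "\<dots> = \<psi> (delta (e j) (e i))" using ij(1,2) by (simp add: delta_def inj_e)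
      finally have "\<psi> (act w' (delta (e j)) (e i) - delta (e j) (e i)) = 0" by (simp add: \<psi>.hom_minus)
      then show ?thesis using ij \<psi>.hom_0 by simp
    qed
    then have "w' = []" using reduced_acts_nontrivially[OF w'(1,2)] by blast
    then have "relator_closure #>\<^bsub>FP\<^esub> A = relator_closure"
      using w'(3) w N.subset by (simp add: word_coset_def flip: one_FP)
    then show "A \<in> relator_closure"
      using F.coset_join1[OF _ _ N.subgroup_axioms] w word_class_carrier by blast
  qed
  then have ker: "relator_closure = kernel FP (GL n) \<Phi>" using sub by blast
  let ?H = "\<Phi> ` carrier FP"
  have H: "subgroup ?H (GL n)" by (rule \<Phi>.img_is_subgroup)
  \<comment> \<open>Cutting the target down to the image makes the map onto, as the first
    isomorphism theorem requires.\<close>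
  interpret \<Phi>': group_hom FP "GL n\<lparr>carrier := ?H\<rparr>" \<Phi>
    using L.subgroup_imp_group[OF H] hom F.group_axioms
    by (auto simp: group_hom_def group_hom_axioms_def hom_def)
  have "FP Mod kernel FP (GL n\<lparr>carrier := ?H\<rparr>) \<Phi> \<cong> GL n\<lparr>carrier := ?H\<rparr>"
    by (rule \<Phi>'.FactGroup_iso) simp
  moreover have "kernel FP (GL n\<lparr>carrier := ?H\<rparr>) \<Phi> = relator_closure"
    unfolding ker by (simp add: kernel_def)
  ultimately have "graph_product V E G \<cong> GL n\<lparr>carrier := ?H\<rparr>"
    by (simp add: graph_product_def)
  moreover have "n \<ge> 1"
    using finite_index by (auto simp: n_def index_def card_gt_0_iff Suc_le_eq)
  ultimately show ?thesis
    using H group_graph_product[OF graph] by (auto simp: linear_over_complex_def)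
qed

end

theorem corollary2:
  fixes V :: "'v set"
    and E :: "'v set set"
    and G :: "'v \<Rightarrow> ('a, 'b) monoid_scheme"
  assumes "finite V"
    and "simplicial_graph V E"
    and "\<And>v. v \<in> V \<Longrightarrow> linear_over_complex (G v)"
  shows "linear_over_complex (graph_product V E G)"
proof -
  have "\<forall>v\<in>V. \<exists>J R q p. mat_rep (G v) (J :: rep_index set) R \<and>
      (\<forall>g\<in>carrier (G v). g \<noteq> \<one>\<^bsub>G v\<^esub> \<longrightarrow>
        (\<exists>r>0. (\<Sum>i\<in>J. \<Sum>j\<in>J. q i * R g i j * p j) - (\<Sum>i\<in>J. q i * p i) = of_real r))"
    using assms(3) linear_positive_coefficient by blast
  then obtain J :: "'v \<Rightarrow> rep_index set" and R q p where *:
    "\<forall>v\<in>V. mat_rep (G v) (J v) (R v) \<and>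
      (\<forall>g\<in>carrier (G v). g \<noteq> \<one>\<^bsub>G v\<^esub> \<longrightarrow>
        (\<exists>r>0. (\<Sum>i\<in>J v. \<Sum>j\<in>J v. q v i * R v g i j * p v j) - (\<Sum>i\<in>J v. q v i * p v i) = of_real r))"
    unfolding bchoice_iff by blast
  interpret positive_family V G E J R q p
  proof (intro positive_family.intro group_family.intro positive_family_axioms.intro)
    show "group (G v)" if "v \<in> V" for v
      using assms(3)[OF that] by (simp add: linear_over_complex_def)
  qed (use assms(1,2) * in blast)+
  show ?thesis by (rule linear_graph_product)
qed

end
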